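(* Let $\Lambda$ be a set of representatives of the isomorphism classes of countable, locally free groups, let $\mathcal{D}$ be the free product of all groups $D\in\Lambda$, let $\mathcal{D}'$ be the normal closure of $\bigcup_{D\in\Lambda}\Gamma D$ in $\mathcal{D}$, and let $h\colon \mathcal{D}\twoheadrightarrow \mathcal{D}/\mathcal{D}'$ be the projection. Consider the natural projection $g\colon \mathcal{D}\to \mathcal{D}/\Gamma\mathcal{D}$. Then $\langle g\rangle=\langle h\rangle$. In other words, $L_gG\cong G/\Gamma G$ for all groups $G$.
   Context: A normal subgroup $H$ of a group $G$ is called $G$-perfect if $H=[H,G]$. Every group $G$ has a maximal $G$-perfect normal subgroup, denoted $\Gamma G$ (it equals the intersection of the transfinite lower central series of $G$). A group is locally free if all its finitely generated subgroups are free. For a group homomorphism $f\colon A\to B$, a group $G$ is $f$-local if $f^*\colon \mathrm{Hom}(B,G)\to\mathrm{Hom}(A,G)$ is a bijection. For every group $G$ there is a homomorphism $l_G\colon G\to L_fG$ which is initial among all homomorphisms from $G$ into $f$-local groups; $L_f$ is the localization functor with respect to $f$. Two homomorphisms $f_1,f_2$ have the same localization class, written $\langle f_1\rangle=\langle f_2\rangle$, if $L_{f_1}$ and $L_{f_2}$ are naturally equivalent. The isomorphism $L_gG\cong G/\Gamma G$ is understood as an isomorphism under $G$, i.e. compatible with $l_G$ and with the quotient map $G\to G/\Gamma G$. *)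

theory Defs
  imports "HOL-Algebra.Elementary_Groups" "HOL-Library.Countable_Set"
begin

definition commutator_subgroup :: "('a, 'b) monoid_scheme \<Rightarrow> 'a set \<Rightarrow> 'a set \<Rightarrow> 'a set" where
  "commutator_subgroup G H K =
     generate G (\<Union>h \<in> H. \<Union>k \<in> K. {h \<otimes>\<^bsub>G\<^esub> k \<otimes>\<^bsub>G\<^esub> inv\<^bsub>G\<^esub> h \<otimes>\<^bsub>G\<^esub> inv\<^bsub>G\<^esub> k})"

definition rel_perfect :: "('a, 'b) monoid_scheme \<Rightarrow> 'a set \<Rightarrow> bool" where
  "rel_perfect G H \<longleftrightarrow> H \<lhd> G \<and> H = commutator_subgroup G H (carrier G)"

text \<open>Well defined for every group by \<open>Gamma_greatest\<close> below.\<close>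

definition Gamma :: "('a, 'b) monoid_scheme \<Rightarrow> 'a set" where
  "Gamma G = (THE M. rel_perfect G M \<and> (\<forall>H. rel_perfect G H \<longrightarrow> H \<subseteq> M))"

lemma (in group) commutators_in_carrier:
  assumes "H \<subseteq> carrier G" "K \<subseteq> carrier G"
  shows "(\<Union>h \<in> H. \<Union>k \<in> K. {h \<otimes> k \<otimes> inv h \<otimes> inv k}) \<subseteq> carrier G"
  using assms by (auto intro!: m_closed inv_closed)

lemma (in group) rel_perfect_join:
  defines "M \<equiv> generate G (\<Union>{H. rel_perfect G H})"
  shows "rel_perfect G M" and "rel_perfect G H \<Longrightarrow> H \<subseteq> M"
proof -
  let ?U = "\<Union>{H. rel_perfect G H}"
  let ?comm = "\<lambda>H. \<Union>h \<in> H. \<Union>k \<in> carrier G. {h \<otimes> k \<otimes> inv h \<otimes> inv k}"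
  have sub: "H \<subseteq> carrier G" if "rel_perfect G H" for H
    using that by (simp add: rel_perfect_def normal_imp_subgroup subgroup.subset)
  have U: "?U \<subseteq> carrier G" using sub by blast
  show le: "H \<subseteq> M" if "rel_perfect G H" for H
    using that unfolding M_def by (auto intro: generate.incl)
  have nM: "M \<lhd> G" unfolding M_def
  proof (rule normal_generateI[OF U])
    fix h g assume "h \<in> ?U" "g \<in> carrier G"
    then show "g \<otimes> h \<otimes> inv g \<in> ?U"
      unfolding rel_perfect_def by (blast intro: normal.inv_op_closed2)
  qed
  have sM: "subgroup M G" using nM by (rule normal_imp_subgroup)
  have MC: "M \<subseteq> carrier G" using sM by (rule subgroup.subset)
  have "?comm M \<subseteq> M"
  proof clarify
    fix m k assume m: "m \<in> M" and k: "k \<in> carrier G"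
    have "k \<otimes> inv m \<otimes> inv k \<in> M"
      using nM m k by (meson normal.inv_op_closed2 sM subgroup.m_inv_closed)
    then have "m \<otimes> (k \<otimes> inv m \<otimes> inv k) \<in> M" using m sM by (meson subgroup.m_closed)
    then show "m \<otimes> k \<otimes> inv m \<otimes> inv k \<in> M" using m k MC by (auto simp: m_assoc)
  qed
  then have 1: "commutator_subgroup G M (carrier G) \<subseteq> M"
    unfolding commutator_subgroup_def using sM by (rule generate_subgroup_incl)
  have sC: "subgroup (commutator_subgroup G M (carrier G)) G"
    unfolding commutator_subgroup_def
    by (rule generate_is_subgroup) (rule commutators_in_carrier[OF MC subset_refl])
  have "H \<subseteq> commutator_subgroup G M (carrier G)" if H: "rel_perfect G H" for H
  proof -
    have "H = generate G (?comm H)"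
      using H unfolding rel_perfect_def commutator_subgroup_def by blast
    also have "\<dots> \<subseteq> generate G (?comm M)"
      by (rule mono_generate) (use le[OF H] in blast)
    finally show ?thesis unfolding commutator_subgroup_def .
  qed
  then have "M \<subseteq> commutator_subgroup G M (carrier G)"
    unfolding M_def by (intro generate_subgroup_incl) (use sC in \<open>auto simp: M_def\<close>)
  with 1 nM show "rel_perfect G M" unfolding rel_perfect_def by blast
qed

lemma (in group) Gamma_greatest:
  "rel_perfect G (Gamma G)" "rel_perfect G H \<Longrightarrow> H \<subseteq> Gamma G"
proof -
  have "\<exists>!M. rel_perfect G M \<and> (\<forall>H. rel_perfect G H \<longrightarrow> H \<subseteq> M)"
    using rel_perfect_join by (meson subset_antisym)
  from theI'[OF this]
  show "rel_perfect G (Gamma G)" "rel_perfect G H \<Longrightarrow> H \<subseteq> Gamma G"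
    unfolding Gamma_def by auto
qed

inductive word_eq :: "('x list \<times> 'x list) set \<Rightarrow> 'x list \<Rightarrow> 'x list \<Rightarrow> bool"
  for R where
    relator: "(u, v) \<in> R \<Longrightarrow> word_eq R (a @ u @ b) (a @ v @ b)"
  | refl: "word_eq R u u"
  | sym: "word_eq R u v \<Longrightarrow> word_eq R v u"
  | trans: "word_eq R u v \<Longrightarrow> word_eq R v w \<Longrightarrow> word_eq R u w"

definition word_class :: "('x list \<times> 'x list) set \<Rightarrow> 'x list \<Rightarrow> 'x list set" where
  "word_class R w = {v. word_eq R w v}"

text \<open>The monoid presented by the alphabet \<open>A\<close> and the relations \<open>R \<subseteq> lists A \<times> lists A\<close>.\<close>

definition presented_monoid :: "'x set \<Rightarrow> ('x list \<times> 'x list) set \<Rightarrow> 'x list set monoid" where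
  "presented_monoid A R =
     \<lparr>carrier = word_class R ` lists A,
      monoid.mult = (\<lambda>U V. \<Union>x \<in> U. \<Union>y \<in> V. word_class R (x @ y)),
      one = word_class R []\<rparr>"

text \<open>The letters \<open>(s, True)\<close> and \<open>(s, False)\<close> stand for \<open>s\<close> and its formal inverse.\<close>

definition free_group :: "'s set \<Rightarrow> ('s \<times> bool) list set monoid" where
  "free_group S =
     presented_monoid (S \<times> UNIV) {([(s, b), (s, \<not> b)], []) | s b. s \<in> S}"

text \<open>Taking \<open>S\<close> in the type of \<open>G\<close> is no restriction: the image of a basis is a basis.\<close>

definition is_free_group :: "('a, 'b) monoid_scheme \<Rightarrow> bool" where
  "is_free_group G \<longleftrightarrow> group G \<and> (\<exists>S :: 'a set. free_group S \<cong> G)"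

definition locally_free :: "('a, 'b) monoid_scheme \<Rightarrow> bool" where
  "locally_free G \<longleftrightarrow> group G \<and>
     (\<forall>S. finite S \<and> S \<subseteq> carrier G \<longrightarrow> is_free_group (subgroup_generated G S))"

definition free_product_relations ::
    "'i set \<Rightarrow> ('i \<Rightarrow> 'a monoid) \<Rightarrow> (('i \<times> 'a) list \<times> ('i \<times> 'a) list) set" where
  "free_product_relations I G =
     {([(i, \<one>\<^bsub>G i\<^esub>)], []) | i. i \<in> I} \<union>
     {([(i, x), (i, y)], [(i, x \<otimes>\<^bsub>G i\<^esub> y)]) | i x y.
        i \<in> I \<and> x \<in> carrier (G i) \<and> y \<in> carrier (G i)}"

definition free_product :: "'i set \<Rightarrow> ('i \<Rightarrow> 'a monoid) \<Rightarrow> ('i \<times> 'a) list set monoid" where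
  "free_product I G =
     presented_monoid (SIGMA i:I. carrier (G i)) (free_product_relations I G)"

definition free_product_incl ::
    "'i set \<Rightarrow> ('i \<Rightarrow> 'a monoid) \<Rightarrow> 'i \<Rightarrow> 'a \<Rightarrow> ('i \<times> 'a) list set" where
  "free_product_incl I G i x = word_class (free_product_relations I G) [(i, x)]"

definition normal_closure :: "('a, 'b) monoid_scheme \<Rightarrow> 'a set \<Rightarrow> 'a set" where
  "normal_closure G S = \<Inter>{N. N \<lhd> G \<and> S \<subseteq> N}"

text \<open>
  Every countable group is isomorphic to one with carrier in \<^typ>\<open>nat\<close>, so the last
  clause says that every isomorphism class of countable, locally free groups is represented.
\<close>

definition countable_locally_free_reps :: "'d monoid set \<Rightarrow> bool" where
  "countable_locally_free_reps \<Lambda> \<longleftrightarrow>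
     (\<forall>D \<in> \<Lambda>. countable (carrier D) \<and> locally_free D) \<and>
     (\<forall>D \<in> \<Lambda>. \<forall>E \<in> \<Lambda>. D \<cong> E \<longrightarrow> D = E) \<and>
     (\<forall>G :: nat monoid. locally_free G \<longrightarrow> (\<exists>D \<in> \<Lambda>. G \<cong> D))"

text \<open>
  Homomorphisms are made extensional, so that equal maps on the carrier are equal
  functions and the universal properties below can use literal uniqueness.
\<close>

definition Hom :: "'a monoid \<Rightarrow> 'b monoid \<Rightarrow> ('a \<Rightarrow> 'b) set" where
  "Hom G H = hom G H \<inter> extensional (carrier G)"

definition quotient_map :: "'a monoid \<Rightarrow> 'a set \<Rightarrow> 'a \<Rightarrow> 'a set" where
  "quotient_map G N = (\<lambda>x \<in> carrier G. N #>\<^bsub>G\<^esub> x)"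

definition local_group ::
    "'x monoid \<Rightarrow> 'y monoid \<Rightarrow> ('x \<Rightarrow> 'y) \<Rightarrow> 'a monoid \<Rightarrow> bool" where
  "local_group A B f G \<longleftrightarrow> group G \<and>
     bij_betw (\<lambda>\<phi>. compose (carrier A) \<phi> f) (Hom B G) (Hom A G)"

text \<open>
  HOL cannot quantify over all types inside a formula, so the type \<^typ>\<open>'c\<close> of the
  groups against which initiality is tested is an explicit parameter.
\<close>

definition is_localization ::
    "'c itself \<Rightarrow> 'x monoid \<Rightarrow> 'y monoid \<Rightarrow> ('x \<Rightarrow> 'y) \<Rightarrow>
     'a monoid \<Rightarrow> 'b monoid \<Rightarrow> ('a \<Rightarrow> 'b) \<Rightarrow> bool" where
  "is_localization _ A B f G L l \<longleftrightarrow>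
     local_group A B f L \<and> l \<in> Hom G L \<and>
     (\<forall>H :: 'c monoid. local_group A B f H \<longrightarrow>
       (\<forall>\<phi> \<in> Hom G H. \<exists>!\<psi>. \<psi> \<in> Hom L H \<and> compose (carrier G) \<psi> l = \<phi>))"

text \<open>
  Endofunctors of the category of groups with carrier in a fixed, arbitrary type \<^typ>\<open>'u\<close>,
  given by their action \<open>F\<close> on objects and \<open>F\<^sub>m\<close> on morphisms.
\<close>

definition group_functor ::
    "('u monoid \<Rightarrow> 'u monoid) \<Rightarrow>
     ('u monoid \<Rightarrow> 'u monoid \<Rightarrow> ('u \<Rightarrow> 'u) \<Rightarrow> 'u \<Rightarrow> 'u) \<Rightarrow> bool" where
  "group_functor F F\<^sub>m \<longleftrightarrow>
     (\<forall>G. group G \<longrightarrow>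
        group (F G) \<and> F\<^sub>m G G (\<lambda>x \<in> carrier G. x) = (\<lambda>x \<in> carrier (F G). x)) \<and>
     (\<forall>G H. group G \<and> group H \<longrightarrow>
        (\<forall>\<phi> \<in> Hom G H. F\<^sub>m G H \<phi> \<in> Hom (F G) (F H))) \<and>
     (\<forall>G H K. group G \<and> group H \<and> group K \<longrightarrow>
        (\<forall>\<phi> \<in> Hom G H. \<forall>\<psi> \<in> Hom H K.
           F\<^sub>m G K (compose (carrier G) \<psi> \<phi>) =
             compose (carrier (F G)) (F\<^sub>m H K \<psi>) (F\<^sub>m G H \<phi>)))"

definition naturally_equivalent ::
    "('u monoid \<Rightarrow> 'u monoid) \<Rightarrow>
     ('u monoid \<Rightarrow> 'u monoid \<Rightarrow> ('u \<Rightarrow> 'u) \<Rightarrow> 'u \<Rightarrow> 'u) \<Rightarrow>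
     ('u monoid \<Rightarrow> 'u monoid) \<Rightarrow>
     ('u monoid \<Rightarrow> 'u monoid \<Rightarrow> ('u \<Rightarrow> 'u) \<Rightarrow> 'u \<Rightarrow> 'u) \<Rightarrow> bool" where
  "naturally_equivalent F F\<^sub>m E E\<^sub>m \<longleftrightarrow>
     (\<exists>\<theta>. (\<forall>G. group G \<longrightarrow> \<theta> G \<in> iso (F G) (E G)) \<and>
        (\<forall>G H. group G \<and> group H \<longrightarrow>
           (\<forall>\<phi> \<in> Hom G H. \<forall>x \<in> carrier (F G). \<theta> H (F\<^sub>m G H \<phi> x) = E\<^sub>m G H \<phi> (\<theta> G x))))"

definition localization_functor ::
    "'x monoid \<Rightarrow> 'y monoid \<Rightarrow> ('x \<Rightarrow> 'y) \<Rightarrow>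
     ('u monoid \<Rightarrow> 'u monoid) \<Rightarrow>
     ('u monoid \<Rightarrow> 'u monoid \<Rightarrow> ('u \<Rightarrow> 'u) \<Rightarrow> 'u \<Rightarrow> 'u) \<Rightarrow>
     ('u monoid \<Rightarrow> 'u \<Rightarrow> 'u) \<Rightarrow> bool" where
  "localization_functor A B f L L\<^sub>m l \<longleftrightarrow>
     group_functor L L\<^sub>m \<and>
     (\<forall>G. group G \<longrightarrow> is_localization TYPE('u) A B f G (L G) (l G)) \<and>
     (\<forall>G H. group G \<and> group H \<longrightarrow>
        (\<forall>\<phi> \<in> Hom G H.
           compose (carrier G) (L\<^sub>m G H \<phi>) (l G) = compose (carrier G) (l H) \<phi>))"

text \<open>
  Localization functors are determined only up to natural equivalence. The relation asserts
  that they exist on the groups over \<^typ>\<open>'u\<close> for both homomorphisms, so that the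
  comparison of all choices is not vacuous.
\<close>

definition same_localization_class ::
    "'u itself \<Rightarrow> 'x monoid \<Rightarrow> 'y monoid \<Rightarrow> ('x \<Rightarrow> 'y) \<Rightarrow>
     'v monoid \<Rightarrow> 'w monoid \<Rightarrow> ('v \<Rightarrow> 'w) \<Rightarrow> bool" where
  "same_localization_class _ A B f A' B' f' \<longleftrightarrow>
     (\<exists>(L :: 'u monoid \<Rightarrow> 'u monoid) L\<^sub>m l. localization_functor A B f L L\<^sub>m l) \<and>
     (\<exists>(L' :: 'u monoid \<Rightarrow> 'u monoid) L'\<^sub>m l'. localization_functor A' B' f' L' L'\<^sub>m l') \<and>
     (\<forall>(L :: 'u monoid \<Rightarrow> 'u monoid) L\<^sub>m l (L' :: 'u monoid \<Rightarrow> 'u monoid) L'\<^sub>m l'.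
        localization_functor A B f L L\<^sub>m l \<and> localization_functor A' B' f' L' L'\<^sub>m l'
          \<longrightarrow> naturally_equivalent L L\<^sub>m L' L'\<^sub>m)"

end

theory Submission
  imports Defs "HOL-Algebra.Weak_Morphisms"
begin

text \<open>
  Both \<open>g\<close> and \<open>h\<close> are quotient maps, so a group \<open>G\<close> is local for one of them iff every
  homomorphism into \<open>G\<close> kills the respective kernel; the claim is that in both cases this
  means \<open>\<Gamma>G = 1\<close>.  Homomorphisms map \<open>\<Gamma>\<close> into \<open>\<Gamma>\<close>, which gives one direction.  For the
  other, every \<open>x \<in> \<Gamma>G\<close> is a product of commutators \<open>[a\<^sub>j, b\<^sub>j]\<close> with \<open>a\<^sub>j \<in> \<Gamma>G\<close>, and
  iterating this yields a tree of elements of \<open>G\<close>.  The same tree of relations between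
  formal letters presents a countable group \<open>T\<close> that is a union of free groups, hence
  locally free by the Nielsen-Schreier theorem; its root letter lies in \<open>\<Gamma>T\<close> and is sent to
  \<open>x\<close> by a homomorphism \<open>T \<rightarrow> G\<close>.  Since \<open>\<Gamma>(G/\<Gamma>G) = 1\<close>, the quotient \<open>G/\<Gamma>G\<close> is the
  reflection of \<open>G\<close> onto the local groups for both maps.
\<close>


section \<open>Free reduction of words\<close>

\<comment> \<open>Keeps the classical provers from unfolding list membership elementwise.\<close>
declare in_listsD [rule del] in_listsI [rule del]

text \<open>\<open>Gamma G\<close> is a transfinite intersection, yet a tree of depth omega suffices
  for each element: \<open>Gamma G\<close> equals its own commutator subgroup with G, so factors can
  be factored again inside it. Only countably many letters occur, whatever the size of G; this lets
  a set of countable groups test all groups.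

  The obstacle is to show that the group of the tree does not collapse. It is the direct limit of
  free groups F_N, and the map from F_N to F_(N+1) replaces each tree letter at depth N by a
  nonempty product of commutators in fresh letters. The first and last letters of this product
  reveal which letter was replaced and with which sign, so nothing cancels at the seams and reduced
  words stay reduced. Hence the maps are injective and each F_N embeds in the limit. An empty
  product would make a letter trivial, which is why commutator lists are kept nonempty.

  Vertices are arbitrary lists of numbers, so F_N has infinite rank for N > 0. A finitely generated
  subgroup of the limit lies in some F_N, and the Nielsen-Schreier theorem is therefore proved for
  arbitrary bases.\<close>

type_synonym 'i word = "('i \<times> bool) list"

definition letter_inv :: "'i \<times> bool \<Rightarrow> 'i \<times> bool" where
  "letter_inv l = (fst l, \<not> snd l)"

definition word_inv :: "'i word \<Rightarrow> 'i word" where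
  "word_inv w = rev (map letter_inv w)"

definition reduced :: "'i word \<Rightarrow> bool" where
  "reduced = successively (\<lambda>l m. m \<noteq> letter_inv l)"

definition push :: "'i \<times> bool \<Rightarrow> 'i word \<Rightarrow> 'i word" where
  "push l w = (if w \<noteq> [] \<and> hd w = letter_inv l then tl w else l # w)"

text \<open>Scanning from the right with \<open>push\<close> yields one definite normal form, so no
  confluence argument about the order of cancellations arises.\<close>

definition reduce :: "'i word \<Rightarrow> 'i word" where
  "reduce w = foldr push w []"

lemma letter_inv_simps [simp]:
  "letter_inv (i, b) = (i, \<not> b)" "letter_inv (letter_inv l) = l"
  "letter_inv l \<noteq> l" "l \<noteq> letter_inv l" "fst (letter_inv l) = fst l"
  by (cases l; simp add: letter_inv_def)+

lemma word_inv_simps [simp]: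
  "word_inv [] = []" "word_inv (l # w) = word_inv w @ [letter_inv l]"
  "word_inv (u @ v) = word_inv v @ word_inv u" "word_inv (word_inv w) = w"
  "word_inv w = [] \<longleftrightarrow> w = []"
  by (auto simp: word_inv_def rev_map o_def)

lemma word_inv_in_lists [simp]: "word_inv w \<in> lists (I \<times> UNIV) \<longleftrightarrow> w \<in> lists (I \<times> UNIV)"
  by (induction w) (auto simp: letter_inv_def)

lemma reduced_Nil [simp]: "reduced []"
  by (simp add: reduced_def)

lemma reduced_Cons: "reduced (l # w) \<longleftrightarrow> reduced w \<and> (w = [] \<or> hd w \<noteq> letter_inv l)"
  by (auto simp: reduced_def successively_Cons)

lemma reduced_append:
  "reduced (u @ v) \<longleftrightarrow>
     reduced u \<and> reduced v \<and> (u = [] \<or> v = [] \<or> hd v \<noteq> letter_inv (last u))"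
  by (auto simp: reduced_def successively_append_iff)

lemma reduced_word_inv: "reduced w \<Longrightarrow> reduced (word_inv w)"
  by (induction w) (auto simp: reduced_Cons reduced_append word_inv_def last_rev hd_map)

lemma push_reduced: "reduced w \<Longrightarrow> reduced (push l w)"
  by (cases w) (auto simp: push_def reduced_Cons)

text \<open>Van der Waerden's trick: on reduced words a letter and its inverse act as mutually
  inverse maps.\<close>

lemma push_push_inv: "reduced w \<Longrightarrow> push l (push (letter_inv l) w) = w"
  by (cases w) (auto simp: push_def reduced_Cons)

lemma reduce_simps [simp]: "reduce [] = []" "reduce (l # w) = push l (reduce w)"
  by (simp_all add: reduce_def)

lemma reduced_reduce [simp]: "reduced (reduce w)"
  by (induction w) (simp_all add: push_reduced)

lemma reduce_reduced: "reduced w \<Longrightarrow> reduce w = w"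
  by (induction w) (auto simp: reduced_Cons push_def)

text \<open>By the action on reduced words, \<open>foldr push u x\<close> depends on u only through
  \<open>reduce u\<close>.\<close>

lemma reduce_cong:
  assumes "reduce u = reduce u'" "reduce v = reduce v'"
  shows "reduce (u @ v) = reduce (u' @ v')"
proof -
  have fold: "foldr push (reduce w) x = foldr push w x" if "reduced x" for w x :: "'a word"
  proof (induction w)
    case (Cons l w)
    have "foldr push (push l (reduce w)) x = push l (foldr push (reduce w) x)"
    proof (cases "reduce w \<noteq> [] \<and> hd (reduce w) = letter_inv l")
      case True
      then obtain y where y: "reduce w = letter_inv l # y" by (cases "reduce w") auto
      have "reduced (foldr push y x)" using that by (induction y) (auto simp: push_reduced)
      moreover have "push l (reduce w) = y" using y by (simp add: push_def)
      ultimately show ?thesis using y by (simp add: push_push_inv)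
    qed (auto simp: push_def)
    with Cons show ?case by simp
  qed simp
  have "reduce (u @ v) = foldr push (reduce u) (reduce v)" for u v :: "'a word"
    using fold[OF reduced_reduce, of u v] by (simp add: reduce_def)
  with assms show ?thesis by metis
qed

lemma reduce_cancel [simp]: "reduce (w @ word_inv w) = []" "reduce (word_inv w @ w) = []"
proof -
  show *: "reduce (w @ word_inv w) = []" for w :: "'a word"
  proof (induction w)
    case (Cons l w)
    have "reduce ((w @ word_inv w) @ [letter_inv l]) = reduce ([] @ [letter_inv l])"
      by (rule reduce_cong) (use Cons in simp_all)
    then show ?case by (simp add: push_def)
  qed simp
  show "reduce (word_inv w @ w) = []" using *[of "word_inv w"] by simp
qed

lemma reduce_append_eq_Nil:
  assumes "reduce (u @ v) = []"
  shows "reduce u = reduce (word_inv v)" "reduce v = reduce (word_inv u)"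
proof -
  have "reduce (word_inv u @ (u @ v)) = reduce (word_inv u @ [])"
    "reduce ((u @ v) @ word_inv v) = reduce ([] @ word_inv v)"
    by (intro reduce_cong; simp add: assms)+
  moreover have "reduce ((word_inv u @ u) @ v) = reduce ([] @ v)"
    "reduce (u @ (v @ word_inv v)) = reduce (u @ [])"
    by (intro reduce_cong; simp)+
  ultimately show "reduce u = reduce (word_inv v)" "reduce v = reduce (word_inv u)"
    by simp_all
qed

lemma reduce_in_lists: "w \<in> lists A \<Longrightarrow> reduce w \<in> lists A"
proof (induction w)
  case (Cons l w)
  then show ?case by (cases "reduce w") (auto simp: push_def)
qed simp

section \<open>Substitutions and walks through graphs\<close>

definition subst_letter :: "('i \<Rightarrow> 'j word) \<Rightarrow> 'i \<times> bool \<Rightarrow> 'j word" where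
  "subst_letter s l = (if snd l then s (fst l) else word_inv (s (fst l)))"

definition subst_word :: "('i \<Rightarrow> 'j word) \<Rightarrow> 'i word \<Rightarrow> 'j word" where
  "subst_word s w = concat (map (subst_letter s) w)"

lemma subst_letter_inv [simp]: "subst_letter s (letter_inv l) = word_inv (subst_letter s l)"
  by (cases l) (simp add: subst_letter_def)

lemma subst_word_simps [simp]:
  "subst_word s [] = []" "subst_word s (l # w) = subst_letter s l @ subst_word s w"
  "subst_word s (u @ v) = subst_word s u @ subst_word s v"
  by (simp_all add: subst_word_def)

lemma subst_word_inv [simp]: "subst_word s (word_inv w) = word_inv (subst_word s w)"
  by (induction w) simp_all

text \<open>
  A map on words that respects concatenation and sends inverse pairs to words that cancel is
  compatible with free reduction.  The extra argument \<open>c\<close> is a state that the letters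
  act on; it is constant for substitutions and ranges over the vertices of a Schreier graph below.
\<close>

primrec walk :: "('c \<Rightarrow> 'l \<Rightarrow> 'c) \<Rightarrow> ('c \<Rightarrow> 'l \<Rightarrow> 'm list) \<Rightarrow> 'c \<Rightarrow> 'l list \<Rightarrow> 'm list" where
  "walk \<delta> out c [] = []"
| "walk \<delta> out c (l # w) = out c l @ walk \<delta> out (\<delta> c l) w"

lemma walk_append: "walk \<delta> out c (u @ v) = walk \<delta> out c u @ walk \<delta> out (foldl \<delta> c u) v"
  by (induction u arbitrary: c) simp_all

lemma reduce_walk_reduce:
  assumes closed: "\<And>c l. c \<in> C \<Longrightarrow> l \<in> A \<Longrightarrow> \<delta> c l \<in> C"
    and revert: "\<And>c l. c \<in> C \<Longrightarrow> l \<in> A \<Longrightarrow> \<delta> (\<delta> c l) (letter_inv l) = c"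
    and cancel: "\<And>c l. c \<in> C \<Longrightarrow> l \<in> A \<Longrightarrow>
      reduce (out c l @ out (\<delta> c l) (letter_inv l)) = []"
  shows "c \<in> C \<Longrightarrow> w \<in> lists A \<Longrightarrow>
    reduce (walk \<delta> out c (reduce w)) = reduce (walk \<delta> out c w)"
proof (induction w arbitrary: c)
  case (Cons l w)
  then have l: "l \<in> A" by simp
  with Cons closed have IH:
    "reduce (walk \<delta> out (\<delta> c l) (reduce w)) = reduce (walk \<delta> out (\<delta> c l) w)"
    by simp
  have "reduce (walk \<delta> out c (push l (reduce w)))
      = reduce (out c l @ walk \<delta> out (\<delta> c l) (reduce w))"
  proof (cases "reduce w \<noteq> [] \<and> hd (reduce w) = letter_inv l")
    \<comment> \<open>The walk crosses l and comes back to the same state by \<open>revert\<close>;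
      \<open>cancel\<close> removes both outputs.\<close>
    case True
    then obtain y where y: "reduce w = letter_inv l # y" by (cases "reduce w") auto
    have "reduce ((out c l @ out (\<delta> c l) (letter_inv l)) @ walk \<delta> out c y)
        = reduce ([] @ walk \<delta> out c y)"
      by (rule reduce_cong) (use cancel[OF Cons.prems(1) l] in simp_all)
    then show ?thesis using y revert[OF Cons.prems(1) l] by (simp add: push_def)
  qed (auto simp: push_def)
  also have "\<dots> = reduce (out c l @ walk \<delta> out (\<delta> c l) w)"
    using IH by (intro reduce_cong) simp_all
  finally show ?case by simp
qed simp

lemma walk_subst_word: "walk (\<lambda>_ _. ()) (\<lambda>_. subst_letter s) () w = subst_word s w"
  by (induction w) simp_all

lemma reduce_subst_cong:
  assumes "reduce u = reduce v"
  shows "reduce (subst_word s u) = reduce (subst_word s v)"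
proof -
  have "reduce (subst_word s (reduce w)) = reduce (subst_word s w)" for w
    using reduce_walk_reduce[of UNIV UNIV "\<lambda>_ _. ()" "\<lambda>_. subst_letter s" "()" w]
    by (simp add: walk_subst_word)
  with assms show ?thesis by metis
qed

text \<open>Together with \<open>subst_word_eq_Nil\<close> this is the criterion for a substitution
  to be injective on a free group: images are nonempty and reduced, and nothing cancels where two
  images meet.\<close>

lemma reduced_subst_word:
  assumes "\<And>l. l \<in> A \<Longrightarrow> subst_letter s l \<noteq> [] \<and> reduced (subst_letter s l)"
    and "\<And>l m. l \<in> A \<Longrightarrow> m \<in> A \<Longrightarrow> m \<noteq> letter_inv l \<Longrightarrow>
      hd (subst_letter s m) \<noteq> letter_inv (last (subst_letter s l))"
  shows "reduced w \<Longrightarrow> w \<in> lists A \<Longrightarrow> reduced (subst_word s w)"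
proof (induction w)
  case (Cons l w)
  show ?case
  proof (cases w)
    case Nil
    with Cons.prems assms(1) show ?thesis by simp
  next
    case (Cons m v)
    with Cons.prems have m: "m \<in> A" "m \<noteq> letter_inv l" by (auto simp: reduced_Cons)
    have "reduced (subst_word s w)" using Cons.IH Cons.prems by (simp add: reduced_Cons)
    then show ?thesis
      using Cons.prems assms(1)[of l] assms(1)[of m] assms(2)[of l m] m
      unfolding Cons by (auto simp: reduced_append)
  qed
qed simp

lemma subst_word_in_lists:
  "s \<in> I \<rightarrow> lists (J \<times> UNIV) \<Longrightarrow> w \<in> lists (I \<times> UNIV) \<Longrightarrow> subst_word s w \<in> lists (J \<times> UNIV)"
  by (induction w) (auto simp: subst_letter_def Pi_iff)

lemma subst_word_eq_Nil:
  "(\<And>l. l \<in> A \<Longrightarrow> subst_letter s l \<noteq> []) \<Longrightarrow> w \<in> lists A \<Longrightarrow> subst_word s w = [] \<longleftrightarrow> w = []"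
  by (cases w) auto


section \<open>Presented groups and free families\<close>

definition list_prod :: "('a, 'b) monoid_scheme \<Rightarrow> ('l \<Rightarrow> 'a) \<Rightarrow> 'l list \<Rightarrow> 'a" where
  "list_prod G f w = foldr (\<lambda>l a. f l \<otimes>\<^bsub>G\<^esub> a) w \<one>\<^bsub>G\<^esub>"

lemma list_prod_simps [simp]:
  "list_prod G f [] = \<one>\<^bsub>G\<^esub>" "list_prod G f (l # w) = f l \<otimes>\<^bsub>G\<^esub> list_prod G f w"
  by (simp_all add: list_prod_def)

lemma list_prod_cong:
  "(\<And>l. l \<in> set w \<Longrightarrow> f l = g l) \<Longrightarrow> list_prod G f w = list_prod G g w"
  by (induction w) simp_all

lemma (in monoid) list_prod_closed:
  "f \<in> A \<rightarrow> carrier G \<Longrightarrow> w \<in> lists A \<Longrightarrow> list_prod G f w \<in> carrier G"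
  by (induction w) (auto simp: Pi_iff)

lemma (in monoid) list_prod_append:
  assumes "f \<in> A \<rightarrow> carrier G" "u \<in> lists A" "v \<in> lists A"
  shows "list_prod G f (u @ v) = list_prod G f u \<otimes> list_prod G f v"
  using assms(2)
proof (induction u)
  case Nil
  then show ?case using list_prod_closed[OF assms(1,3)] by simp
next
  case (Cons l u)
  moreover have "f l \<in> carrier G" using Cons assms(1) by auto
  ultimately show ?case
    using list_prod_closed[OF assms(1), of u] list_prod_closed[OF assms(1,3)] by (simp add: m_assoc)
qed

lemma (in group_hom) hom_list_prod:
  "f \<in> A \<rightarrow> carrier G \<Longrightarrow> w \<in> lists A \<Longrightarrow> h (list_prod G f w) = list_prod H (\<lambda>l. h (f l)) w"
proof (induction w)
  case (Cons l w)
  moreover have "f l \<in> carrier G" using Cons.prems by auto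
  ultimately show ?case by (simp add: G.list_prod_closed)
qed simp

lemma word_eq_append:
  assumes "word_eq R u u'" "word_eq R v v'"
  shows "word_eq R (u @ v) (u' @ v')"
proof -
  have ctx: "word_eq R (a @ x @ b) (a @ y @ b)" if "word_eq R x y" for a b x y
    using that
  proof (induction)
    case (relator x y c d)
    then show ?case using word_eq.relator[of x y R "a @ c" "d @ b"] by simp
  qed (auto intro: word_eq.intros)
  have "word_eq R (u @ v) (u' @ v)" using ctx[OF assms(1), of "[]" v] by simp
  moreover have "word_eq R (u' @ v) (u' @ v')" using ctx[OF assms(2), of u' "[]"] by simp
  ultimately show ?thesis by (rule word_eq.trans)
qed

lemma (in monoid) list_prod_word_eq:
  assumes f: "\<And>l. f l \<in> carrier G"
    and R: "\<And>u v. (u, v) \<in> R \<Longrightarrow> list_prod G f u = list_prod G f v"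
    and "word_eq R u v"
  shows "list_prod G f u = list_prod G f v"
  using assms(3)
proof induction
  case (relator u v a b)
  have "f \<in> UNIV \<rightarrow> carrier G" using f by blast
  from list_prod_append[OF this] R[OF relator] show ?case by simp
qed simp_all

lemma word_class_eq_iff: "word_class R u = word_class R v \<longleftrightarrow> word_eq R u v"
  unfolding word_class_def by (auto intro: word_eq.intros)

lemma carrier_presented_monoid: "carrier (presented_monoid A R) = word_class R ` lists A"
  and one_presented_monoid: "\<one>\<^bsub>presented_monoid A R\<^esub> = word_class R []"
  by (simp_all add: presented_monoid_def)

lemma mult_presented_monoid:
  "word_class R u \<otimes>\<^bsub>presented_monoid A R\<^esub> word_class R v = word_class R (u @ v)"
proof -
  have "word_class R (x @ y) = word_class R (u @ v)"
    if "x \<in> word_class R u" "y \<in> word_class R v" for x y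
    using that unfolding word_class_eq_iff
    by (auto simp: word_class_def intro: word_eq_append word_eq.sym)
  moreover have "u \<in> word_class R u" "v \<in> word_class R v"
    by (simp_all add: word_class_def word_eq.refl)
  ultimately have "(\<Union>x \<in> word_class R u. \<Union>y \<in> word_class R v. word_class R (x @ y)) =
      word_class R (u @ v)"
    by blast
  then show ?thesis by (simp add: presented_monoid_def)
qed

lemmas presented_monoid_simps =
  carrier_presented_monoid one_presented_monoid mult_presented_monoid

text \<open>Left inverses of single letters suffice: concatenated in reverse order they give left
  inverses of words.\<close>

lemma group_presented_monoid:
  assumes inv: "\<And>a. a \<in> A \<Longrightarrow> \<exists>w \<in> lists A. word_eq R (w @ [a]) []"
  shows "group (presented_monoid A R)" (is "group ?P")
proof (rule groupI)
  fix x assume "x \<in> carrier ?P"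
  then obtain u where u: "u \<in> lists A" "x = word_class R u" by (auto simp: carrier_presented_monoid)
  have "\<exists>w \<in> lists A. word_eq R (w @ u) []" using u(1)
  proof (induction u)
    case Nil
    then show ?case using word_eq.refl by fastforce
  next
    case (Cons a u)
    then obtain w where w: "w \<in> lists A" "word_eq R (w @ u) []" by auto
    obtain v where v: "v \<in> lists A" "word_eq R (v @ [a]) []" using inv Cons.hyps by blast
    have "word_eq R (w @ (v @ [a]) @ u) (w @ [] @ u)"
      by (intro word_eq_append word_eq.refl v)
    with w have "word_eq R ((w @ v) @ a # u) []" by (auto intro: word_eq.trans)
    with v w show ?case by (intro bexI[of _ "w @ v"]) auto
  qed
  then show "\<exists>y \<in> carrier ?P. y \<otimes>\<^bsub>?P\<^esub> x = \<one>\<^bsub>?P\<^esub>"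
    by (auto simp: u presented_monoid_simps word_class_eq_iff)
qed (auto simp: presented_monoid_simps)

text \<open>The values of f must lie in the group for every letter of the type, because the contexts
  in \<open>word_eq\<close> may contain letters outside A. Callers extend their maps by the identity
  element.\<close>

lemma (in group) presented_monoid_hom:
  assumes f: "\<And>l. f l \<in> carrier G"
    and R: "\<And>u v. (u, v) \<in> R \<Longrightarrow> list_prod G f u = list_prod G f v"
  obtains \<phi> where "\<phi> \<in> hom (presented_monoid A R) G"
    and "\<And>w. \<phi> (word_class R w) = list_prod G f w"
proof
  have fU: "f \<in> UNIV \<rightarrow> carrier G" using f by blast
  define \<phi> where "\<phi> U = list_prod G f (SOME w. w \<in> U)" for U
  show \<phi>: "\<phi> (word_class R w) = list_prod G f w" for w
  proof -
    have "(SOME v. v \<in> word_class R w) \<in> word_class R w"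
      by (rule someI[of _ w]) (simp add: word_class_def word_eq.refl)
    then have "word_eq R w (SOME v. v \<in> word_class R w)" by (simp add: word_class_def)
    from list_prod_word_eq[OF f R this] show ?thesis by (simp add: \<phi>_def)
  qed
  show "\<phi> \<in> hom (presented_monoid A R) G"
    by (rule homI) (auto simp: presented_monoid_simps \<phi> list_prod_append[OF fU]
      list_prod_closed[OF fU])
qed

section \<open>Values of words and free families\<close>

definition signed :: "('a, 'b) monoid_scheme \<Rightarrow> ('i \<Rightarrow> 'a) \<Rightarrow> 'i \<times> bool \<Rightarrow> 'a" where
  "signed G x l = (if snd l then x (fst l) else inv\<^bsub>G\<^esub> x (fst l))"

abbreviation word_value :: "('a, 'b) monoid_scheme \<Rightarrow> ('i \<Rightarrow> 'a) \<Rightarrow> 'i word \<Rightarrow> 'a" where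
  "word_value G x \<equiv> list_prod G (signed G x)"

lemma signed_simps [simp]:
  "signed G x (i, True) = x i" "signed G x (i, False) = inv\<^bsub>G\<^esub> x i"
  by (simp_all add: signed_def)

text \<open>A family instead of a set keeps the labels of a basis in a type of their own.
  Injectivity on I is implied, by the words with values x_i x_j^(-1).\<close>

definition free_family :: "('a, 'b) monoid_scheme \<Rightarrow> 'i set \<Rightarrow> ('i \<Rightarrow> 'a) \<Rightarrow> bool" where
  "free_family G I x \<longleftrightarrow> x \<in> I \<rightarrow> carrier G \<and>
     (\<forall>w \<in> lists (I \<times> UNIV). reduced w \<and> word_value G x w = \<one>\<^bsub>G\<^esub> \<longrightarrow> w = [])"

context group
begin

lemma signed_in_carrier: "x \<in> I \<rightarrow> carrier G \<Longrightarrow> signed G x \<in> I \<times> UNIV \<rightarrow> carrier G"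
  by (auto simp: signed_def Pi_iff)

lemmas word_value_closed = list_prod_closed[OF signed_in_carrier]
  and word_value_append = list_prod_append[OF signed_in_carrier]

lemma signed_letter_inv:
  assumes "x \<in> I \<rightarrow> carrier G" "l \<in> I \<times> UNIV"
  shows "signed G x (letter_inv l) = inv (signed G x l)"
  using assms by (cases l) (auto simp: signed_def Pi_iff)

lemma word_value_inv:
  assumes x: "x \<in> I \<rightarrow> carrier G" and w: "w \<in> lists (I \<times> UNIV)"
  shows "word_value G x (word_inv w) = inv (word_value G x w)"
  using w
proof (induction w)
  case (Cons l w)
  then have "[letter_inv l] \<in> lists (I \<times> UNIV)" by (auto simp: letter_inv_def)
  moreover have "signed G x l \<in> carrier G" using Cons signed_in_carrier[OF x] by auto
  ultimately show ?case
    using Cons signed_letter_inv[OF x, of l] word_value_closed[OF x, of w]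
    by (simp add: word_value_append[OF x] inv_mult_group)
qed simp

lemma word_value_reduce:
  assumes x: "x \<in> I \<rightarrow> carrier G" and w: "w \<in> lists (I \<times> UNIV)"
  shows "word_value G x (reduce w) = word_value G x w"
  using w
proof (induction w)
  case (Cons l w)
  then have l: "l \<in> I \<times> UNIV" "signed G x l \<in> carrier G" using signed_in_carrier[OF x] by auto
  show ?case
  proof (cases "reduce w \<noteq> [] \<and> hd (reduce w) = letter_inv l")
    case True
    then obtain y where y: "reduce w = letter_inv l # y" by (cases "reduce w") auto
    have "reduce w \<in> lists (I \<times> UNIV)" using Cons.hyps by (auto intro: reduce_in_lists)
    then have "y \<in> lists (I \<times> UNIV)" using y by simp
    then have "word_value G x y \<in> carrier G" by (rule word_value_closed[OF x])
    moreover have "word_value G x w = inv (signed G x l) \<otimes> word_value G x y"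
      using Cons y signed_letter_inv[OF x l(1)] by simp
    ultimately show ?thesis using y l by (simp add: push_def m_assoc[symmetric])
  qed (use Cons in \<open>auto simp: push_def\<close>)
qed simp

lemma word_value_subst_word:
  assumes x: "x \<in> J \<rightarrow> carrier G" and s: "s \<in> I \<rightarrow> lists (J \<times> UNIV)"
    and w: "w \<in> lists (I \<times> UNIV)"
  shows "word_value G x (subst_word s w) = word_value G (\<lambda>i. word_value G x (s i)) w"
  using w
proof (induction w)
  case (Cons l w)
  then have "s (fst l) \<in> lists (J \<times> UNIV)" using s by auto
  with Cons subst_word_in_lists[OF s, of w] show ?case
    by (simp add: word_value_append[OF x] subst_letter_def signed_def[of G _ l] word_value_inv[OF x])
qed simp

lemma generate_image_eq_word_values:
  assumes x: "x \<in> I \<rightarrow> carrier G"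
  shows "generate G (x ` I) = word_value G x ` lists (I \<times> UNIV)"
proof
  show "generate G (x ` I) \<subseteq> word_value G x ` lists (I \<times> UNIV)"
  proof
    fix g assume "g \<in> generate G (x ` I)"
    then show "g \<in> word_value G x ` lists (I \<times> UNIV)"
    proof induction
      case one
      show ?case by (rule image_eqI[of _ _ "[]"]) simp_all
    next
      case (incl h)
      then obtain i where "i \<in> I" "h = x i" by blast
      with x show ?case by (intro image_eqI[of _ _ "[(i, True)]"]) (auto simp: Pi_iff)
    next
      case (inv h)
      then obtain i where "i \<in> I" "h = x i" by blast
      with x show ?case by (intro image_eqI[of _ _ "[(i, False)]"]) (auto simp: Pi_iff)
    next
      case (eng h1 h2)
      then obtain u v where "u \<in> lists (I \<times> UNIV)" "v \<in> lists (I \<times> UNIV)"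
        "h1 = word_value G x u" "h2 = word_value G x v" by blast
      then show ?case
        by (intro image_eqI[of _ _ "u @ v"]) (simp_all add: word_value_append[OF x])
    qed
  qed
  have "word_value G x w \<in> generate G (x ` I)" if "w \<in> lists (I \<times> UNIV)" for w
    using that by (induction w) (auto simp: signed_def intro!: generate.eng intro: generate.intros)
  then show "word_value G x ` lists (I \<times> UNIV) \<subseteq> generate G (x ` I)" by blast
qed

lemma free_familyD:
  assumes "free_family G I x" "w \<in> lists (I \<times> UNIV)" "word_value G x w = \<one>"
  shows "reduce w = []"
proof -
  have "x \<in> I \<rightarrow> carrier G" using assms(1) by (simp add: free_family_def)
  with assms have "word_value G x (reduce w) = \<one>" by (simp add: word_value_reduce)
  with assms show ?thesis by (auto simp: free_family_def dest: reduce_in_lists)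
qed

text \<open>\<open>is_free_group\<close> expects the basis in the type of the group, so the labels I
  are exchanged for the image S; normal forms then give injectivity of the evaluation map.\<close>

lemma is_free_groupI:
  assumes ff: "free_family G I x" and gen: "generate G (x ` I) = carrier G"
  shows "is_free_group G"
proof -
  define S where "S = x ` I"
  \<comment> \<open>The inclusion of S, extended by the identity element to all letters as
    \<open>presented_monoid_hom\<close> requires.\<close>
  define b where "b s = (if s \<in> S then s else \<one>)" for s
  define R :: "('a word \<times> 'a word) set" where "R = {([(s, c), (s, \<not> c)], []) | s c. s \<in> S}"
  have xc: "x \<in> I \<rightarrow> carrier G" using ff by (simp add: free_family_def)
  have bc: "b \<in> UNIV \<rightarrow> carrier G" using xc by (auto simp: b_def S_def)
  have bval: "word_value G b (map (map_prod x id) w) = word_value G x w"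
    if "w \<in> lists (I \<times> UNIV)" for w
    using that by (induction w) (auto simp: signed_def b_def S_def)
  \<comment> \<open>A reduced word over S lifts to a word over I, and the lift is reduced because
    relabelling commutes with inverting letters.\<close>
  have triv: "reduce w = []" if w: "w \<in> lists (S \<times> UNIV)" "word_value G b w = \<one>" for w
  proof -
    have "reduce w \<in> lists (S \<times> UNIV)" using w by (auto intro: reduce_in_lists)
    also have "S \<times> UNIV = map_prod x id ` (I \<times> (UNIV :: bool set))"
      by (simp add: S_def map_prod_surj_on)
    finally obtain v where v: "v \<in> lists (I \<times> UNIV)" "reduce w = map (map_prod x id) v"
      by (auto simp: lists_image)
    have "reduced (map (map_prod x id) v)" using v(2) reduced_reduce by metis
    then have "reduced v"
      unfolding reduced_def successively_map
      by (rule successively_mono) (auto simp: letter_inv_def)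
    moreover have "word_value G x v = \<one>"
      using bval[OF v(1)] v(2) word_value_reduce[OF bc, of w] w(2) by simp
    ultimately have "v = []" using ff v(1) by (auto simp: free_family_def)
    with v show ?thesis by simp
  qed
  \<comment> \<open>Each cancellation made by \<open>push\<close> is an instance of a defining
    relation, so equal normal forms give equal classes.\<close>
  have red: "word_eq R w (reduce w)" if "w \<in> lists (S \<times> UNIV)" for w
    using that
  proof (induction w)
    case (Cons l w)
    then have "word_eq R (l # w) (l # reduce w)"
      using word_eq_append[OF word_eq.refl[of R "[l]"], of w "reduce w"] by simp
    moreover have "word_eq R (l # reduce w) (push l (reduce w))"
    proof (cases "reduce w \<noteq> [] \<and> hd (reduce w) = letter_inv l")
      case True
      then obtain y where y: "reduce w = letter_inv l # y" by (cases "reduce w") auto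
      have "([l, letter_inv l], []) \<in> R" using Cons.hyps by (cases l) (auto simp: R_def)
      from word_eq.relator[OF this, of "[]" y] show ?thesis using y by (simp add: push_def)
    qed (auto simp: push_def intro: word_eq.refl)
    ultimately show ?case by (auto intro: word_eq.trans)
  qed (simp add: word_eq.refl)
  have free: "free_group S = presented_monoid (S \<times> UNIV) R"
    by (simp add: free_group_def R_def)
  have "signed G b l \<in> carrier G" for l using signed_in_carrier[OF bc] by (cases l) auto
  moreover have "word_value G b u = word_value G b v" if "(u, v) \<in> R" for u v
    using that bc by (auto simp: R_def signed_def Pi_iff)
  ultimately obtain \<phi> where \<phi>: "\<phi> \<in> hom (free_group S) G"
    "\<And>w. \<phi> (word_class R w) = word_value G b w"
    using presented_monoid_hom[of "signed G b" R "S \<times> UNIV"] unfolding free by blast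
  have "inj_on \<phi> (carrier (free_group S))"
  proof (rule inj_onI)
    fix U V assume "U \<in> carrier (free_group S)" "V \<in> carrier (free_group S)" "\<phi> U = \<phi> V"
    then obtain u v where uv: "u \<in> lists (S \<times> UNIV)" "v \<in> lists (S \<times> UNIV)"
      "U = word_class R u" "V = word_class R v" "word_value G b u = word_value G b v"
      by (auto simp: free presented_monoid_simps \<phi>)
    then have "u \<in> lists (UNIV \<times> UNIV)" "v \<in> lists (UNIV \<times> UNIV)" by auto
    with uv have "word_value G b (u @ word_inv v) = \<one>"
      using word_value_append[OF bc, of u "word_inv v"] word_value_inv[OF bc, of v]
        word_value_closed[OF bc, of v] by simp
    moreover have "u @ word_inv v \<in> lists (S \<times> UNIV)"
      using uv(1,2) by simp
    ultimately have "reduce u = reduce v"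
      using triv[of "u @ word_inv v"] reduce_append_eq_Nil(1)[of u "word_inv v"] by simp
    then have "word_eq R u v" using red[OF uv(1)] red[OF uv(2)] by (metis word_eq.intros(3,4))
    then show "U = V" using uv by (simp add: word_class_eq_iff)
  qed
  moreover have "\<phi> ` carrier (free_group S) = carrier G"
  proof -
    have "\<phi> ` carrier (free_group S) = word_value G b ` lists (S \<times> UNIV)"
      by (simp add: free presented_monoid_simps \<phi>(2) image_image)
    also have "\<dots> = word_value G id ` lists (S \<times> UNIV)"
      by (intro image_cong refl list_prod_cong) (auto simp: signed_def b_def dest!: in_listsD)
    also have "\<dots> = generate G S"
      using generate_image_eq_word_values[of id S] xc by (simp add: S_def image_subset_iff_funcset[symmetric] image_subset_iff Pi_iff)
    finally show ?thesis using gen S_def by simp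
  qed
  ultimately have "\<phi> \<in> iso (free_group S) G" using \<phi>(1) by (simp add: iso_iff)
  then show ?thesis unfolding is_free_group_def using is_isoI is_group by blast
qed

end


section \<open>Subgroups of free groups are free\<close>

text \<open>
  \<open>tree_path par n c\<close> is the word read along the \<open>n\<close> edges from the root to
  \<open>c\<close>, where \<open>par\<close> sends a vertex to its parent and the label of the edge
  coming from it.
\<close>

primrec tree_path :: "('c \<Rightarrow> 'c \<times> 'l) \<Rightarrow> nat \<Rightarrow> 'c \<Rightarrow> 'l list" where
  "tree_path par 0 c = []"
| "tree_path par (Suc n) c = tree_path par n (fst (par c)) @ [snd (par c)]"

text \<open>A geodesic tree: cutting the last letter off a shortest word leads to a vertex one step
  closer to the root. The words p are closed under prefixes, as in a Schreier transversal.\<close>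

lemma spanning_tree:
  assumes reach: "\<And>c. c \<in> C \<Longrightarrow> \<exists>w \<in> lists A. foldl \<delta> r w = c"
    and closed: "\<And>w. w \<in> lists A \<Longrightarrow> foldl \<delta> r w \<in> C"
  obtains p where "p r = []"
    and "\<And>c. c \<in> C \<Longrightarrow> p c \<in> lists A \<and> foldl \<delta> r (p c) = c"
    and "\<And>c. c \<in> C \<Longrightarrow> c \<noteq> r \<Longrightarrow> \<exists>c' \<in> C. \<exists>l \<in> A. p c = p c' @ [l] \<and> \<delta> c' l = c"
proof -
  define dist where "dist c = (LEAST n. \<exists>w \<in> lists A. foldl \<delta> r w = c \<and> length w = n)" for c
  have dist_le: "dist (foldl \<delta> r w) \<le> length w" if "w \<in> lists A" for w
    unfolding dist_def by (rule Least_le) (use that in blast)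
  have dist_ex: "\<exists>w \<in> lists A. foldl \<delta> r w = c \<and> length w = dist c" if "c \<in> C" for c
    using LeastI_ex[of "\<lambda>n. \<exists>w \<in> lists A. foldl \<delta> r w = c \<and> length w = n"] reach[OF that]
    unfolding dist_def by blast
  define is_par where "is_par c cl \<longleftrightarrow> fst cl \<in> C \<and> snd cl \<in> A \<and>
    \<delta> (fst cl) (snd cl) = c \<and> dist c = Suc (dist (fst cl))" for c cl
  have ex: "\<exists>cl. is_par c cl" if c: "c \<in> C" "c \<noteq> r" for c
  proof -
    obtain w where w: "w \<in> lists A" "foldl \<delta> r w = c" "length w = dist c"
      using dist_ex[OF c(1)] by blast
    with c(2) obtain v l where v: "w = v @ [l]" by (cases w rule: rev_cases) auto
    then have vA: "v \<in> lists A" "l \<in> A" using w(1) by auto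
    let ?c = "foldl \<delta> r v"
    have c': "?c \<in> C" using closed vA by blast
    obtain u where u: "u \<in> lists A" "foldl \<delta> r u = ?c" "length u = dist ?c"
      using dist_ex[OF c'] by blast
    \<comment> \<open>With the next inequality this forces equality, so \<open>dist\<close> drops by
      exactly one towards the parent.\<close>
    have "dist c \<le> Suc (dist ?c)" using dist_le[of "u @ [l]"] u vA w v by simp
    moreover have "dist ?c < dist c" using dist_le[OF vA(1)] w v by simp
    ultimately show ?thesis using c' vA w v by (intro exI[of _ "(?c, l)"]) (auto simp: is_par_def)
  qed
  define par where "par c = (SOME cl. is_par c cl)" for c
  have par: "fst (par c) \<in> C" "snd (par c) \<in> A" "\<delta> (fst (par c)) (snd (par c)) = c"
    "dist c = Suc (dist (fst (par c)))" if "c \<in> C" "c \<noteq> r" for c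
    using someI_ex[OF ex[OF that]] by (simp_all add: is_par_def par_def)
  \<comment> \<open>The distance is the exact number of parent steps after which the recursion
    arrives at r.\<close>
  define p where "p c = tree_path par (dist c) c" for c
  have "dist r = 0" using dist_le[of "[]"] by simp
  then have pr: "p r = []" by (simp add: p_def)
  have step: "p c = p (fst (par c)) @ [snd (par c)]" if "c \<in> C" "c \<noteq> r" for c
    using par[OF that] by (simp add: p_def)
  have "p c \<in> lists A \<and> foldl \<delta> r (p c) = c" if "c \<in> C" "dist c = n" for c n
    using that
  proof (induction n arbitrary: c)
    case 0
    then have "c = r" using par(4)[of c] by fastforce
    with pr show ?case by simp
  next
    case (Suc n)
    show ?case
    proof (cases "c = r")
      case True
      with pr show ?thesis by simp
    next
      case False
      with Suc par step show ?thesis by simp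
    qed
  qed
  with pr step par show thesis by (intro that[of p]) blast+
qed

text \<open>
  The proof walks through the Schreier graph of \<open>H\<close> along a word in the free generators and
  writes down the edges used outside a spanning tree.  The output respects free reduction, and
  the word of the Schreier generator of an edge is translated back to that edge, so a reduced
  word in the Schreier generators with trivial value is empty.
\<close>

theorem (in group) Nielsen_Schreier:
  fixes x :: "'i \<Rightarrow> 'a"
  assumes ff: "free_family G I x" and H: "subgroup H G" "H \<subseteq> generate G (x ` I)"
  obtains J and y :: "'a set \<times> 'i \<Rightarrow> 'a" where "free_family G J y" "generate G (y ` J) = H"
proof -
  have x: "x \<in> I \<rightarrow> carrier G" using ff by (simp add: free_family_def)
  have HC: "H \<subseteq> carrier G" using H(1) by (rule subgroup.subset)
  let ?L = "I \<times> (UNIV :: bool set)"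
  define \<delta> where "\<delta> c l = c #> signed G x l" for c l
  \<comment> \<open>Only the cosets reachable from H are vertices: the family may generate a proper
    subgroup of G.\<close>
  define C where "C = foldl \<delta> H ` lists ?L"
  note sc = signed_in_carrier[OF x] and val = word_value_closed[OF x]
  have foldl_\<delta>: "foldl \<delta> c w = c #> word_value G x w"
    if "w \<in> lists ?L" "c \<subseteq> carrier G" for c w
    using that
  proof (induction w arbitrary: c)
    case (Cons l w)
    then have l: "signed G x l \<in> carrier G" using sc by auto
    with Cons have "\<delta> c l \<subseteq> carrier G" by (simp add: \<delta>_def r_coset_subset_G)
    with Cons l val[of w] show ?case by (simp add: coset_mult_assoc \<delta>_def)
  qed simp
  have Ccar: "c \<subseteq> carrier G" if "c \<in> C" for c
  proof -
    from that obtain w where "w \<in> lists ?L" "c = foldl \<delta> H w" by (auto simp: C_def)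
    then show ?thesis using HC val[of w] by (simp add: foldl_\<delta> r_coset_subset_G)
  qed
  have \<delta>C: "\<delta> c l \<in> C" if cl: "c \<in> C" "l \<in> ?L" for c l
  proof -
    from cl obtain w where "w \<in> lists ?L" "c = foldl \<delta> H w" by (auto simp: C_def)
    with cl(2) show ?thesis unfolding C_def by (intro image_eqI[of _ _ "w @ [l]"]) auto
  qed
  have \<delta>inv: "\<delta> (\<delta> c l) (letter_inv l) = c" if "c \<in> C" "l \<in> ?L" for c l
    using Ccar[OF that(1)] funcset_mem[OF sc that(2)] signed_letter_inv[OF x that(2)]
    by (simp add: \<delta>_def coset_mult_assoc)
  have HinC: "H \<in> C" by (auto simp: C_def intro: image_eqI[of _ _ "[]"])
  have linv: "letter_inv l \<in> ?L" if "l \<in> ?L" for l using that by (cases l) auto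

  have "\<exists>w \<in> lists ?L. foldl \<delta> H w = c" if "c \<in> C" for c using that by (auto simp: C_def)
  moreover have "foldl \<delta> H w \<in> C" if "w \<in> lists ?L" for w using that by (auto simp: C_def)
  ultimately obtain p where pH: "p H = []"
    and p: "\<And>c. c \<in> C \<Longrightarrow> p c \<in> lists ?L \<and> foldl \<delta> H (p c) = c"
    and p_step: "\<And>c. c \<in> C \<Longrightarrow> c \<noteq> H \<Longrightarrow>
      \<exists>c' \<in> C. \<exists>l \<in> ?L. p c = p c' @ [l] \<and> \<delta> c' l = c"
    using spanning_tree[of C ?L \<delta> H] by blast

  \<comment> \<open>Positively labelled edges outside the tree. There are two exclusions because the
    tree may use an edge in either direction.\<close>
  define J where "J = {(c, i). c \<in> C \<and> i \<in> I \<and> p (\<delta> c (i, True)) \<noteq> p c @ [(i, True)] \<and>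
    p c \<noteq> p (\<delta> c (i, True)) @ [(i, False)]}"
  \<comment> \<open>The Schreier generator of an edge: down the tree to its source, across it, and
    back from its target to the root.\<close>
  define s where "s = (\<lambda>(c, i). p c @ [(i, True)] @ word_inv (p (\<delta> c (i, True))))"
  define y where "y j = word_value G x (s j)" for j
  \<comment> \<open>A negative letter traverses backwards the edge that starts at its endpoint, so
    it records the inverse of that edge.\<close>
  define out where "out c l = (let e = if snd l then (c, fst l) else (\<delta> c l, fst l)
    in if e \<in> J then [(e, snd l)] else [])" for c l
  note [simp] = walk_append

  have sJ: "s \<in> J \<rightarrow> lists ?L"
    using p \<delta>C by (auto simp: J_def s_def)
  have yJ: "y \<in> J \<rightarrow> carrier G" unfolding y_def using val funcset_mem[OF sJ] by blast
  have cancel: "reduce (out c l @ out (\<delta> c l) (letter_inv l)) = []"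
    if "c \<in> C" "l \<in> ?L" for c l
    using \<delta>inv[OF that] by (cases l) (auto simp: out_def Let_def push_def)
  have walk_reduce: "reduce (walk \<delta> out c (reduce w)) = reduce (walk \<delta> out c w)"
    if "c \<in> C" "w \<in> lists ?L" for c w
    by (rule reduce_walk_reduce[OF _ _ _ that]) (rule \<delta>C \<delta>inv cancel; assumption)+
  \<comment> \<open>Paths in the tree use only edges excluded from J and hence record
    nothing.\<close>
  have walk_p: "walk \<delta> out H (p c) = []" if "c \<in> C" for c
    using that
  proof (induction c rule: measure_induct_rule[where f = "\<lambda>c. length (p c)"])
    case (less c)
    show ?case
    proof (cases "c = H")
      case False
      then obtain c' i b where c': "c' \<in> C" "i \<in> I" "p c = p c' @ [(i, b)]" "\<delta> c' (i, b) = c"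
        using p_step[OF less.prems] by auto
      then have "walk \<delta> out H (p c') = []" using less.IH by simp
      moreover have "out c' (i, b) = []"
        using c' \<delta>inv[of c' "(i, b)"] by (cases b) (auto simp: out_def J_def)
      ultimately show ?thesis using p[OF c'(1)] c'(3) by simp
    qed (simp add: pH)
  qed
  \<comment> \<open>Obtained from the cancellation of \<open>w @ word_inv w\<close>, which avoids
    tracing the walk backwards.\<close>
  have walk_inv: "reduce (walk \<delta> out (foldl \<delta> H w) (word_inv w))
      = reduce (word_inv (walk \<delta> out H w))" if w: "w \<in> lists ?L" for w
  proof -
    have "reduce (walk \<delta> out H (w @ word_inv w)) = []"
      using walk_reduce[OF HinC, of "w @ word_inv w"] w by simp
    then show ?thesis using reduce_append_eq_Nil(2) by simp blast
  qed
  have fold_inv: "foldl \<delta> (foldl \<delta> H w) (word_inv w) = H" if w: "w \<in> lists ?L" for w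
    using w
  proof (induction w rule: rev_induct)
    case (snoc l w)
    then have "foldl \<delta> H w \<in> C" by (auto simp: C_def)
    with snoc \<delta>inv[of "foldl \<delta> H w" l] show ?case by simp
  qed simp
  \<comment> \<open>The word of j is a loop at H. Both tree parts are silent, so exactly the edge j
    is recorded.\<close>
  have s_walk: "foldl \<delta> H (s j) = H \<and> reduce (walk \<delta> out H (s j)) = [(j, True)]"
    if "j \<in> J" for j
  proof -
    obtain c i where j: "j = (c, i)" by force
    with that have ci: "c \<in> C" "i \<in> I" by (auto simp: J_def)
    define d where "d = \<delta> c (i, True)"
    have d: "d \<in> C" using \<delta>C ci by (simp add: d_def)
    have "reduce (walk \<delta> out d (word_inv (p d))) = []"
      using walk_inv[of "p d"] p[OF d] walk_p[OF d] by simp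
    then have "reduce ([(j, True)] @ walk \<delta> out d (word_inv (p d))) = reduce ([(j, True)] @ [])"
      by (intro reduce_cong) simp_all
    moreover have "out c (i, True) = [(j, True)]" using that j by (simp add: out_def)
    ultimately show ?thesis
      using p[OF ci(1)] walk_p[OF ci(1)] p[OF d] fold_inv[of "p d"] j
      by (simp add: s_def d_def[symmetric] push_def)
  qed
  have sl_walk: "foldl \<delta> H (subst_letter s l) = H \<and>
      reduce (walk \<delta> out H (subst_letter s l)) = [l]" if "l \<in> J \<times> UNIV" for l
  proof (cases "snd l")
    case True
    with that s_walk[of "fst l"] show ?thesis by (cases l) (auto simp: subst_letter_def)
  next
    case False
    define j where "j = fst l"
    have l: "l = (j, False)" "j \<in> J"
      using that False by (auto simp: j_def prod_eq_iff mem_Times_iff)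
    have sj: "s j \<in> lists ?L" using sJ l by auto
    have "reduce (walk \<delta> out H (word_inv (s j)) @ []) = reduce (word_inv (walk \<delta> out H (s j)))"
      using walk_inv[OF sj] s_walk[OF l(2)] by simp
    also have "\<dots> = reduce (word_inv [(j, True)])"
    proof -
      have "reduce (walk \<delta> out H (s j) @ word_inv [(j, True)]) = reduce ([(j, True)] @ word_inv [(j, True)])"
        by (intro reduce_cong) (use s_walk[OF l(2)] in \<open>simp_all add: push_def\<close>)
      then show ?thesis using reduce_append_eq_Nil(2) by (metis reduce_cancel(1))
    qed
    finally show ?thesis using fold_inv[OF sj] s_walk[OF l(2)] l by (simp add: subst_letter_def push_def)
  qed
  \<comment> \<open>Up to free reduction, the walk is a left inverse of the substitution s.\<close>
  have walk_subst: "foldl \<delta> H (subst_word s v) = H \<and>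
      reduce (walk \<delta> out H (subst_word s v)) = reduce v" if "v \<in> lists (J \<times> UNIV)" for v
    using that
  proof (induction v)
    case (Cons l v)
    then have l: "foldl \<delta> H (subst_letter s l) = H"
      "reduce (walk \<delta> out H (subst_letter s l)) = reduce [l]"
      using sl_walk by (auto simp: push_def)
    have "reduce (walk \<delta> out H (subst_letter s l) @ walk \<delta> out H (subst_word s v)) = reduce ([l] @ v)"
      using Cons l by (intro reduce_cong) simp_all
    with Cons l show ?case by simp
  qed simp

  have "free_family G J y"
    unfolding free_family_def
  proof (intro conjI ballI impI yJ)
    fix v assume v: "v \<in> lists (J \<times> UNIV)" "reduced v \<and> word_value G y v = \<one>"
    have "word_value G x (subst_word s v) = \<one>" "subst_word s v \<in> lists ?L"
      using word_value_subst_word[OF x sJ v(1)] subst_word_in_lists[OF sJ v(1)] v(2)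
      by (simp_all add: y_def[abs_def])
    \<comment> \<open>Freeness of x moves the problem to normal forms; applying the walk then
      recovers v.\<close>
    then have "reduce (subst_word s v) = []" using free_familyD[OF ff] by blast
    then have "reduce (walk \<delta> out H (subst_word s v)) = []"
      using walk_reduce[OF HinC \<open>subst_word s v \<in> lists ?L\<close>] by simp
    with walk_subst[OF v(1)] v(2) show "v = []" by (simp add: reduce_reduced)
  qed
  moreover have "generate G (y ` J) = H"
  proof
    have "y j \<in> H" if j: "j \<in> J" for j
    proof -
      have "s j \<in> lists ?L" using sJ j by auto
      with s_walk[OF j] have "H #> y j = H" "y j \<in> carrier G"
        using foldl_\<delta> HC val by (auto simp: y_def)
      then show ?thesis using coset_join1 H(1) by blast
    qed
    then show "generate G (y ` J) \<subseteq> H" using H(1) by (intro generate_subgroup_incl) auto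
  next
    have out: "out c l \<in> lists (J \<times> UNIV)" for c l by (simp add: out_def Let_def)
    \<comment> \<open>Reidemeister rewriting of one letter: the representative of c times the letter
      equals the recorded output times the representative of the next coset. On a tree edge the
      output is trivial.\<close>
    have val_out: "word_value G x (p c) \<otimes> signed G x l =
        word_value G y (out c l) \<otimes> word_value G x (p (\<delta> c l))" if cl: "c \<in> C" "l \<in> ?L" for c l
    proof -
      have edge: "word_value G y (out c (i, True)) =
          word_value G x (p c) \<otimes> x i \<otimes> inv (word_value G x (p (\<delta> c (i, True))))"
        if ci: "c \<in> C" "i \<in> I" for c i
      proof -
        define d where "d = \<delta> c (i, True)"
        have d: "d \<in> C" using \<delta>C ci by (simp add: d_def)
        have cc: "x i \<in> carrier G" "word_value G x (p c) \<in> carrier G"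
          "word_value G x (p d) \<in> carrier G"
          using ci d x p val by auto
        show ?thesis
        proof (cases "(c, i) \<in> J")
          case True
          have "y (c, i) = word_value G x (p c) \<otimes> (x i \<otimes> inv (word_value G x (p d)))"
            using ci p[OF ci(1)] p[OF d] word_value_inv[OF x, of "p d"]
            by (simp add: y_def s_def d_def[symmetric] word_value_append[OF x])
          with True cc yJ show ?thesis by (simp add: out_def d_def[symmetric] m_assoc)
        next
          case False
          with ci have "p d = p c @ [(i, True)] \<or> p c = p d @ [(i, False)]"
            by (auto simp: J_def d_def)
          then have "word_value G x (p c) \<otimes> x i = word_value G x (p d)"
          proof
            assume "p d = p c @ [(i, True)]"
            with ci p[OF ci(1)] cc show ?thesis by (simp add: word_value_append[OF x])
          next
            assume "p c = p d @ [(i, False)]"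
            with ci p[OF d] cc show ?thesis by (simp add: word_value_append[OF x] m_assoc)
          qed
          with False cc show ?thesis by (simp add: out_def d_def[symmetric])
        qed
      qed
      have cc: "word_value G x (p c) \<in> carrier G" "word_value G x (p (\<delta> c l)) \<in> carrier G"
        "signed G x l \<in> carrier G"
        using cl \<delta>C[OF cl] p val sc by auto
      show ?thesis
      proof (cases "snd l")
        case True
        with cl edge[of c "fst l"] cc show ?thesis by (cases l) (auto simp: m_assoc)
      next
        case False
        then obtain i where l: "l = (i, False)" "i \<in> I" using cl by (cases l) auto
        define d where "d = \<delta> c l"
        have d: "d \<in> C" "\<delta> d (i, True) = c" using \<delta>C[OF cl] \<delta>inv[OF cl] l by (simp_all add: d_def)
        have xi: "x i \<in> carrier G" using x l by auto
        have "out c l = word_inv (out d (i, True))"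
          using l by (simp add: out_def d_def Let_def)
        then have "word_value G y (out c l) = inv (word_value G y (out d (i, True)))"
          using word_value_inv[OF yJ out] by simp
        also have "\<dots> = inv (word_value G x (p d) \<otimes> x i \<otimes> inv (word_value G x (p c)))"
          using edge[OF d(1) l(2)] d(2) by simp
        also have "\<dots> = word_value G x (p c) \<otimes> inv (x i) \<otimes> inv (word_value G x (p d))"
          using cc xi by (simp add: inv_mult_group m_assoc d_def[symmetric])
        finally show ?thesis using cc xi l by (simp add: d_def m_assoc)
      qed
    qed
    \<comment> \<open>The one-letter identities telescope along the word.\<close>
    have rewrite: "word_value G x (p c) \<otimes> word_value G x w =
        word_value G y (walk \<delta> out c w) \<otimes> word_value G x (p (foldl \<delta> c w)) \<and>
        walk \<delta> out c w \<in> lists (J \<times> UNIV) \<and> foldl \<delta> c w \<in> C"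
      if "w \<in> lists ?L" "c \<in> C" for w c
      using that
    proof (induction w arbitrary: c)
      case (Cons l w)
      then have cl: "c \<in> C" "l \<in> ?L" by auto
      note IH = Cons.IH[OF \<delta>C[OF cl]]
      have cc: "word_value G x (p c) \<in> carrier G" "word_value G x (p (\<delta> c l)) \<in> carrier G"
        "signed G x l \<in> carrier G" "word_value G x w \<in> carrier G"
        "word_value G x (p (foldl \<delta> (\<delta> c l) w)) \<in> carrier G"
        "word_value G y (out c l) \<in> carrier G"
        "word_value G y (walk \<delta> out (\<delta> c l) w) \<in> carrier G"
        using cl \<delta>C[OF cl] p val sc IH Cons.hyps word_value_closed[OF yJ] out by auto
      have "word_value G x (p c) \<otimes> word_value G x (l # w) =
          (word_value G x (p c) \<otimes> signed G x l) \<otimes> word_value G x w"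
        using cc by (simp add: m_assoc)
      also have "\<dots> = word_value G y (out c l) \<otimes>
          (word_value G x (p (\<delta> c l)) \<otimes> word_value G x w)"
        using val_out[OF cl] cc by (simp add: m_assoc)
      also have "\<dots> = word_value G y (out c l @ walk \<delta> out (\<delta> c l) w) \<otimes>
          word_value G x (p (foldl \<delta> (\<delta> c l) w))"
        using IH cc out by (simp add: word_value_append[OF yJ] m_assoc)
      finally show ?case using IH out by simp
    qed (use pH p val in auto)
    show "H \<subseteq> generate G (y ` J)"
    proof
      fix h assume h: "h \<in> H"
      with H(2) obtain w where w: "w \<in> lists ?L" "h = word_value G x w"
        unfolding generate_image_eq_word_values[OF x] by blast
      \<comment> \<open>A word with value in H closes up at H, whose tree path is empty, so the
        rewriting leaves only the output of the walk.\<close>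
      have "foldl \<delta> H w = H"
        using foldl_\<delta>[OF w(1) HC] w h H(1) coset_join2[OF val H(1)] by simp
      then have "h = word_value G y (walk \<delta> out H w)" "walk \<delta> out H w \<in> lists (J \<times> UNIV)"
        using rewrite[OF w(1) HinC] pH w val[OF w(1)] word_value_closed[OF yJ] by auto
      then show "h \<in> generate G (y ` J)"
        unfolding generate_image_eq_word_values[OF yJ] by blast
    qed
  qed
  ultimately show thesis by (rule that)
qed

text \<open>The free subgroup around S may have any rank; the Nielsen-Schreier theorem passes from
  it to the subgroup generated by S.\<close>

lemma (in group) locally_freeI:
  assumes "\<And>S. finite S \<Longrightarrow> S \<subseteq> carrier G \<Longrightarrow>
    \<exists>I (x :: 'i \<Rightarrow> 'a). free_family G I x \<and> S \<subseteq> generate G (x ` I)"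
  shows "locally_free G"
  unfolding locally_free_def
proof (intro conjI allI impI is_group)
  fix S assume S: "finite S \<and> S \<subseteq> carrier G"
  then obtain I and x :: "'i \<Rightarrow> 'a" where x: "free_family G I x" "S \<subseteq> generate G (x ` I)"
    using assms by blast
  define H where "H = generate G S"
  have H: "subgroup H G" using S by (simp add: H_def generate_is_subgroup)
  have "x ` I \<subseteq> carrier G" using x(1) by (auto simp: free_family_def)
  then have "H \<subseteq> generate G (x ` I)"
    unfolding H_def using x(2) by (intro generate_subgroup_incl generate_is_subgroup)
  then obtain J and y :: "'a set \<times> 'i \<Rightarrow> 'a" where y: "free_family G J y" "generate G (y ` J) = H"
    using Nielsen_Schreier[OF x(1) H] by blast
  let ?K = "subgroup_generated G S"
  have K: "carrier ?K = H" using S by (simp add: carrier_subgroup_generated H_def Int_absorb1)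
  have yc: "y \<in> J \<rightarrow> carrier G" using y(1) by (simp add: free_family_def)
  have yK: "y \<in> J \<rightarrow> carrier ?K" using y(2) K by (auto intro: generate.incl)
  interpret K: group ?K by simp
  have val: "word_value ?K y w = word_value G y w" if "w \<in> lists (J \<times> UNIV)" for w
    using that
  proof (induction w)
    case (Cons l w)
    have "inv\<^bsub>?K\<^esub> y (fst l) = inv y (fst l)" using Cons.hyps yK by (intro inv_subgroup_generated) auto
    with Cons show ?case by (simp add: signed_def)
  qed simp
  have "free_family ?K J y" using y(1) yK val by (simp add: free_family_def)
  moreover have "generate ?K (y ` J) = carrier ?K"
    using generate_image_eq_word_values[OF yc] K.generate_image_eq_word_values[OF yK] val y(2) K
    by (metis (no_types, lifting) image_cong)
  ultimately show "is_free_group ?K" by (rule K.is_free_groupI)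
qed


section \<open>The maximal relatively perfect subgroup\<close>

lemma (in group) mult_inv_cancel:
  "x \<in> carrier G \<Longrightarrow> y \<in> carrier G \<Longrightarrow> x \<otimes> (inv x \<otimes> y) = y"
  "x \<in> carrier G \<Longrightarrow> y \<in> carrier G \<Longrightarrow> inv x \<otimes> (x \<otimes> y) = y"
  by (simp_all add: m_assoc[symmetric])

lemma (in group) commutator_subgroup_mono:
  "A \<subseteq> A' \<Longrightarrow> B \<subseteq> B' \<Longrightarrow> commutator_subgroup G A B \<subseteq> commutator_subgroup G A' B'"
  unfolding commutator_subgroup_def by (rule mono_generate) blast

lemma (in group) commutator_in_commutator_subgroup:
  "a \<in> A \<Longrightarrow> b \<in> B \<Longrightarrow> a \<otimes> b \<otimes> inv a \<otimes> inv b \<in> commutator_subgroup G A B"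
  unfolding commutator_subgroup_def by (blast intro: generate.incl)

lemma (in group) subgroup_commutator_subgroup:
  "A \<subseteq> carrier G \<Longrightarrow> B \<subseteq> carrier G \<Longrightarrow> subgroup (commutator_subgroup G A B) G"
  unfolding commutator_subgroup_def by (intro generate_is_subgroup commutators_in_carrier)

text \<open>A conjugate of a commutator is the commutator of the conjugates, and the first entry
  stays in N.\<close>

lemma (in group) normal_commutator_subgroup:
  assumes "N \<lhd> G"
  shows "commutator_subgroup G N (carrier G) \<lhd> G"
proof -
  interpret N: normal N G by fact
  show ?thesis
    unfolding commutator_subgroup_def
  proof (rule normal_generateI)
    fix c g
    assume c: "c \<in> (\<Union>h\<in>N. \<Union>k\<in>carrier G. {h \<otimes> k \<otimes> inv h \<otimes> inv k})" and g: "g \<in> carrier G"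
    then obtain h k where hk: "h \<in> N" "k \<in> carrier G" "c = h \<otimes> k \<otimes> inv h \<otimes> inv k" by blast
    let ?h = "g \<otimes> h \<otimes> inv g" and ?k = "g \<otimes> k \<otimes> inv g"
    have "h \<in> carrier G" using hk N.subset by blast
    with hk g have "g \<otimes> c \<otimes> inv g = ?h \<otimes> ?k \<otimes> inv ?h \<otimes> inv ?k"
      by (simp add: m_assoc inv_mult_group mult_inv_cancel)
    moreover have "?h \<in> N" "?k \<in> carrier G" using hk g N.inv_op_closed2 by auto
    ultimately show "g \<otimes> c \<otimes> inv g \<in> (\<Union>h\<in>N. \<Union>k\<in>carrier G. {h \<otimes> k \<otimes> inv h \<otimes> inv k})"
      by blast
  qed (rule commutators_in_carrier[OF N.subset subset_refl])
qed

lemma (in group) commutator_subgroup_le_normal: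
  assumes "N \<lhd> G"
  shows "commutator_subgroup G N (carrier G) \<subseteq> N"
proof -
  interpret N: normal N G by fact
  have "h \<otimes> k \<otimes> inv h \<otimes> inv k \<in> N" if "h \<in> N" "k \<in> carrier G" for h k
  proof -
    have "h \<otimes> (k \<otimes> inv h \<otimes> inv k) \<in> N" using that N.inv_op_closed2 by auto
    then show ?thesis using that N.subset by (simp add: m_assoc subset_iff)
  qed
  then show ?thesis
    unfolding commutator_subgroup_def
    by (intro generate_subgroup_incl N.subgroup_axioms) blast
qed

lemma (in group) Gamma_normal: "Gamma G \<lhd> G"
  and Gamma_eq_commutator_subgroup: "Gamma G = commutator_subgroup G (Gamma G) (carrier G)"
  using Gamma_greatest(1) by (simp_all add: rel_perfect_def)

lemma (in group) subset_GammaI: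
  assumes "N \<lhd> G" "N \<subseteq> commutator_subgroup G N (carrier G)"
  shows "N \<subseteq> Gamma G"
  using assms commutator_subgroup_le_normal by (intro Gamma_greatest(2)) (auto simp: rel_perfect_def)

lemma (in group) subset_normal_closure: "S \<subseteq> normal_closure G S"
  by (auto simp: normal_closure_def)

lemma (in group) normal_closure_least: "N \<lhd> G \<Longrightarrow> S \<subseteq> N \<Longrightarrow> normal_closure G S \<subseteq> N"
  by (auto simp: normal_closure_def)

lemma (in group) normal_normal_closure:
  assumes "S \<subseteq> carrier G"
  shows "normal_closure G S \<lhd> G"
proof -
  have carr: "carrier G \<lhd> G"
    by (simp add: normal_inv_iff subgroup_self)
  have sub: "subgroup (normal_closure G S) G"
    unfolding normal_closure_def
    by (rule subgroups_Inter) (use carr assms in \<open>auto intro: normal_imp_subgroup\<close>)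
  have conj: "g \<otimes> h \<otimes> inv g \<in> N"
    if "g \<in> carrier G" "h \<in> normal_closure G S" "N \<lhd> G" "S \<subseteq> N" for g h N
    using normal.inv_op_closed2[OF that(3,1)] normal_closure_least[OF that(3,4)] that(2) by blast
  have "g \<otimes> h \<otimes> inv g \<in> normal_closure G S"
    if "g \<in> carrier G" "h \<in> normal_closure G S" for g h
    using conj[OF that] by (subst normal_closure_def) blast
  with sub show ?thesis by (simp add: normal_inv_iff)
qed

text \<open>The commutator subgroup of a normal subgroup with G is normal, so it contains the whole
  normal closure of S once it contains S. Only generators have to be tested.\<close>

lemma (in group) subset_Gamma_via_normal_closure:
  assumes S: "S \<subseteq> carrier G"
    and "S \<subseteq> commutator_subgroup G (normal_closure G S) (carrier G)"
  shows "S \<subseteq> Gamma G"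
  using subset_GammaI[OF normal_normal_closure[OF S]] subset_normal_closure[of S]
    normal_closure_least[OF normal_commutator_subgroup[OF normal_normal_closure[OF S]] assms(2)]
  by blast

lemma (in group_hom) image_commutator_subgroup:
  assumes "A \<subseteq> carrier G" "B \<subseteq> carrier G"
  shows "h ` commutator_subgroup G A B = commutator_subgroup H (h ` A) (h ` B)"
proof -
  have "h ` (\<Union>a\<in>A. \<Union>b\<in>B. {a \<otimes> b \<otimes> inv a \<otimes> inv b}) =
      (\<Union>a\<in>h ` A. \<Union>b\<in>h ` B. {a \<otimes>\<^bsub>H\<^esub> b \<otimes>\<^bsub>H\<^esub> inv\<^bsub>H\<^esub> a \<otimes>\<^bsub>H\<^esub> inv\<^bsub>H\<^esub> b})"
    using assms by (simp add: image_UN subset_iff)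
  then show ?thesis
    unfolding commutator_subgroup_def
    using generate_img[OF G.commutators_in_carrier[OF assms]] by simp
qed

text \<open>The image need not be normal when h is not surjective; its normal closure takes its
  place.\<close>

lemma (in group_hom) image_Gamma_subset: "h ` Gamma G \<subseteq> Gamma H"
proof -
  have sub: "Gamma G \<subseteq> carrier G"
    using G.Gamma_normal by (simp add: normal_imp_subgroup subgroup.subset)
  have "h ` Gamma G = commutator_subgroup H (h ` Gamma G) (h ` carrier G)"
    using image_commutator_subgroup[OF sub subset_refl] G.Gamma_eq_commutator_subgroup by simp
  also have "\<dots> \<subseteq> commutator_subgroup H (normal_closure H (h ` Gamma G)) (carrier H)"
    by (intro H.commutator_subgroup_mono H.subset_normal_closure) auto
  finally show ?thesis
    using sub by (intro H.subset_Gamma_via_normal_closure) auto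
qed

text \<open>Let M be the preimage of \<open>Gamma H\<close>. An x in M agrees under h with some k in
  [M, G], and x k^(-1) lies in the kernel \<open>Gamma G\<close>, which equals [Gamma G, G] and so
  lies in [M, G]. Thus M is contained in [M, G], and M lies in the kernel.\<close>

lemma (in group_hom) Gamma_trivial_of_kernel_eq_Gamma:
  assumes surj: "h ` carrier G = carrier H" and ker: "kernel G H h = Gamma G"
  shows "Gamma H = {\<one>\<^bsub>H\<^esub>}"
proof -
  interpret QN: normal "Gamma H" H by (rule H.Gamma_normal)
  define M where "M = {x \<in> carrier G. h x \<in> Gamma H}"
  have "\<one> \<in> M" by (simp add: M_def)
  then have "subgroup M G" by (intro G.subgroupI) (auto simp: M_def)
  moreover have "g \<otimes> m \<otimes> inv g \<in> M" if "g \<in> carrier G" "m \<in> M" for g m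
    using that QN.inv_op_closed2[of "h g" "h m"] by (auto simp: M_def)
  ultimately have M: "M \<lhd> G" by (simp add: G.normal_inv_iff)
  have GM: "Gamma G \<subseteq> M" by (auto simp: M_def kernel_def simp flip: ker)
  have img: "h ` M = Gamma H" using QN.subset unfolding M_def surj[symmetric] by blast
  let ?K = "commutator_subgroup G M (carrier G)"
  have sK: "subgroup ?K G"
    using M by (simp add: G.subgroup_commutator_subgroup normal_imp_subgroup subgroup.subset)
  have "M \<subseteq> ?K"
  proof
    fix x assume x: "x \<in> M"
    have "h x \<in> commutator_subgroup H (h ` M) (h ` carrier G)"
      unfolding img surj using x H.Gamma_eq_commutator_subgroup by (simp add: M_def)
    also have "\<dots> = h ` ?K"
      by (rule image_commutator_subgroup[symmetric]) (auto simp: M_def)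
    finally obtain k where k: "k \<in> ?K" "h x = h k" by blast
    have xk: "x \<in> carrier G" "k \<in> carrier G"
      using x k subgroup.mem_carrier[OF sK] by (auto simp: M_def)
    then have "x \<otimes> inv k \<in> Gamma G" using k by (simp add: kernel_def flip: ker)
    then have "x \<otimes> inv k \<in> ?K"
      using G.Gamma_eq_commutator_subgroup G.commutator_subgroup_mono[OF GM subset_refl] by blast
    from subgroup.m_closed[OF sK this k(1)] show "x \<in> ?K" using xk by (simp add: G.m_assoc)
  qed
  then have "M \<subseteq> Gamma G" by (rule G.subset_GammaI[OF M])
  then have "h ` M \<subseteq> {\<one>\<^bsub>H\<^esub>}" unfolding ker[symmetric] by (auto simp: kernel_def)
  then show ?thesis using img QN.one_closed by blast
qed

text \<open>Nonempty lists are what makes the branching numbers of the telescope positive; the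
  identity is therefore written as one trivial commutator.\<close>

lemma (in group) commutator_subgroup_list_prod:
  assumes "N \<lhd> G" "y \<in> commutator_subgroup G N (carrier G)"
  shows "\<exists>ps \<in> lists (N \<times> carrier G). ps \<noteq> [] \<and>
    y = list_prod G (\<lambda>(a, b). a \<otimes> b \<otimes> inv a \<otimes> inv b) ps"
proof -
  interpret N: normal N G by fact
  let ?c = "\<lambda>(a, b). a \<otimes> b \<otimes> inv a \<otimes> inv b"
  have c: "?c \<in> N \<times> carrier G \<rightarrow> carrier G" by auto
  show ?thesis
    using assms(2) unfolding commutator_subgroup_def
  proof induction
    case one
    show ?case by (rule bexI[of _ "[(\<one>, \<one>)]"]) auto
  next
    case (incl y)
    then obtain a b where "a \<in> N" "b \<in> carrier G" "y = a \<otimes> b \<otimes> inv a \<otimes> inv b" by blast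
    then show ?case by (intro bexI[of _ "[(a, b)]"]) auto
  next
    case (inv y)
    then obtain a b where ab: "a \<in> N" "b \<in> carrier G" "y = a \<otimes> b \<otimes> inv a \<otimes> inv b" by blast
    \<comment> \<open>\<open>[a, b]\<^sup>-\<^sup>1 = [b a b\<^sup>-\<^sup>1, b\<^sup>-\<^sup>1]\<close>\<close>
    then have "inv y = ?c (b \<otimes> a \<otimes> inv b, inv b)"
      by (simp add: inv_mult_group m_assoc mult_inv_cancel)
    with ab show ?case
      by (intro bexI[of _ "[(b \<otimes> a \<otimes> inv b, inv b)]"]) (auto intro: N.inv_op_closed2)
  next
    case (eng y z)
    then obtain ps qs where "ps \<in> lists (N \<times> carrier G)" "qs \<in> lists (N \<times> carrier G)" "ps \<noteq> []"
      "y = list_prod G ?c ps" "z = list_prod G ?c qs" by blast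
    then show ?case by (intro bexI[of _ "ps @ qs"]) (simp_all add: list_prod_append[OF c])
  qed
qed


section \<open>Telescopes of free groups\<close>

text \<open>
  The letters are \<open>Inl w\<close> and \<open>Inr w\<close> for vertices \<open>w\<close> of an infinite
  tree, and \<open>Inl w\<close> stands for the product of the commutators
  \<open>[Inl (w @ [j]), Inr (w @ [j])]\<close>, \<open>j < k w\<close>.  \<open>unfold_word k n\<close> applies
  these substitutions down to level \<open>n\<close>.
\<close>

type_synonym node = "nat list + nat list"

definition comm_word :: "'i \<Rightarrow> 'i \<Rightarrow> 'i word" where
  "comm_word a b = [(a, True), (b, True), (a, False), (b, False)]"

definition comm_block :: "nat list \<Rightarrow> nat list \<Rightarrow> node word" where
  "comm_block w js = concat (map (\<lambda>j. comm_word (Inl (w @ [j])) (Inr (w @ [j]))) js)"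

definition expand :: "(nat list \<Rightarrow> nat) \<Rightarrow> nat \<Rightarrow> node \<Rightarrow> node word" where
  "expand k n a = (case a of
     Inl w \<Rightarrow> if length w = n then comm_block w [0..<k w] else [(a, True)]
   | Inr w \<Rightarrow> [(a, True)])"

primrec unfold_word :: "(nat list \<Rightarrow> nat) \<Rightarrow> nat \<Rightarrow> node word \<Rightarrow> node word" where
  "unfold_word k 0 u = u"
| "unfold_word k (Suc n) u = subst_word (expand k n) (unfold_word k n u)"

text \<open>Equality in a direct limit: two words are identified once they agree at some level. By
  \<open>word_eq_telescope\<close> these relations already form the congruence they
  generate.\<close>

definition telescope_relations :: "(nat list \<Rightarrow> nat) \<Rightarrow> (node word \<times> node word) set" where
  "telescope_relations k = {(u, v). \<exists>n. reduce (unfold_word k n u) = reduce (unfold_word k n v)}"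

definition telescope :: "(nat list \<Rightarrow> nat) \<Rightarrow> node word set monoid" where
  "telescope k = presented_monoid UNIV (telescope_relations k)"

definition telescope_gen :: "(nat list \<Rightarrow> nat) \<Rightarrow> node \<Rightarrow> node word set" where
  "telescope_gen k a = word_class (telescope_relations k) [(a, True)]"

text \<open>\<open>nodes_between N N\<close> is the basis of the N-th free group: tree letters at
  depth N and all partner letters \<open>Inr w\<close> created so far, which are never
  replaced.\<close>

definition nodes_between :: "nat \<Rightarrow> nat \<Rightarrow> node set" where
  "nodes_between n N = {Inl w | w. n \<le> length w \<and> length w \<le> N} \<union> {Inr w | w. length w \<le> N}"

lemma comm_block_simps [simp]:
  "comm_block w [] = []"
  "comm_block w (j # js) = comm_word (Inl (w @ [j])) (Inr (w @ [j])) @ comm_block w js"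
  "comm_block w (js @ js') = comm_block w js @ comm_block w js'"
  by (simp_all add: comm_block_def)

lemma unfold_word_append [simp]: "unfold_word k n (u @ v) = unfold_word k n u @ unfold_word k n v"
  by (induction n) simp_all

lemma unfold_word_Nil [simp]: "unfold_word k n [] = []"
  by (induction n) simp_all

lemma reduce_unfold_word_mono:
  assumes "reduce (unfold_word k n u) = reduce (unfold_word k n v)" "n \<le> m"
  shows "reduce (unfold_word k m u) = reduce (unfold_word k m v)"
  using assms(2)
proof (induction rule: dec_induct)
  case base
  show ?case by (rule assms(1))
next
  case (step m)
  from reduce_subst_cong[OF step.IH] show ?case by simp
qed

lemma telescope_relations_iff:
  "(u, v) \<in> telescope_relations k \<longleftrightarrow>
     (\<exists>n. reduce (unfold_word k n u) = reduce (unfold_word k n v))"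
  by (simp add: telescope_relations_def)

lemma word_eq_telescope: "word_eq (telescope_relations k) u v \<longleftrightarrow> (u, v) \<in> telescope_relations k"
proof
  assume "word_eq (telescope_relations k) u v"
  then show "(u, v) \<in> telescope_relations k"
  proof induction
    case (relator u v a b)
    then show ?case by (auto simp: telescope_relations_iff intro!: reduce_cong)
  next
    case (trans u v w)
    then obtain n m where "reduce (unfold_word k n u) = reduce (unfold_word k n v)"
      "reduce (unfold_word k m v) = reduce (unfold_word k m w)"
      by (auto simp: telescope_relations_iff)
    then have "reduce (unfold_word k (max n m) u) = reduce (unfold_word k (max n m) w)"
      using reduce_unfold_word_mono[of k n u v "max n m"]
        reduce_unfold_word_mono[of k m v w "max n m"] by simp
    then show ?case by (auto simp: telescope_relations_iff)
  next
    case (sym u v)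
    then show ?case by (auto simp: telescope_relations_iff intro: HOL.sym)
  qed (auto simp: telescope_relations_iff)
next
  assume "(u, v) \<in> telescope_relations k"
  from word_eq.relator[OF this, of "[]" "[]"] show "word_eq (telescope_relations k) u v" by simp
qed

lemma telescope_simps:
  "carrier (telescope k) = range (word_class (telescope_relations k))"
  "\<one>\<^bsub>telescope k\<^esub> = word_class (telescope_relations k) []"
  "word_class (telescope_relations k) u \<otimes>\<^bsub>telescope k\<^esub> word_class (telescope_relations k) v =
     word_class (telescope_relations k) (u @ v)"
  by (simp_all add: telescope_def presented_monoid_simps)

lemma telescope_gen_closed [simp]: "telescope_gen k a \<in> carrier (telescope k)"
  by (simp add: telescope_gen_def telescope_simps)

lemma telescope_gen_funcset: "telescope_gen k \<in> I \<rightarrow> carrier (telescope k)"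
  by simp

lemma word_class_telescope_eq:
  "reduce (unfold_word k n u) = reduce (unfold_word k n v) \<Longrightarrow>
     word_class (telescope_relations k) u = word_class (telescope_relations k) v"
  by (auto simp: word_class_eq_iff word_eq_telescope telescope_relations_iff)

lemma group_telescope: "group (telescope k)"
  unfolding telescope_def
proof (rule group_presented_monoid)
  fix l :: "node \<times> bool"
  have "reduce (unfold_word k 0 ([letter_inv l] @ [l])) = reduce (unfold_word k 0 [])"
    by (simp add: push_def)
  moreover have "[letter_inv l] \<in> lists UNIV" by simp
  ultimately show "\<exists>w \<in> lists UNIV. word_eq (telescope_relations k) (w @ [l]) []"
    unfolding word_eq_telescope telescope_relations_iff by blast
qed

lemma word_value_telescope_gen:
  "word_value (telescope k) (telescope_gen k) w = word_class (telescope_relations k) w"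
proof (induction w)
  case (Cons l w)
  interpret T: group "telescope k" by (rule group_telescope)
  have "word_class (telescope_relations k) [(a, False)] \<otimes>\<^bsub>telescope k\<^esub> telescope_gen k a =
      \<one>\<^bsub>telescope k\<^esub>" for a
    unfolding telescope_gen_def telescope_simps
    by (rule word_class_telescope_eq[of k 0]) (simp add: push_def)
  then have "inv\<^bsub>telescope k\<^esub> telescope_gen k a = word_class (telescope_relations k) [(a, False)]"
    for a by (rule T.inv_equality) (simp_all add: telescope_simps telescope_gen_def)
  then have "signed (telescope k) (telescope_gen k) l = word_class (telescope_relations k) [l]"
    by (cases l) (simp add: signed_def telescope_gen_def)
  with Cons show ?case by (simp add: telescope_simps)
qed (simp add: telescope_simps)

text \<open>The tree relations suffice for a homomorphism, because under \<open>rel\<close> neither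
  unfolding nor free reduction changes the value of a word.\<close>

lemma (in group) telescope_hom:
  assumes e: "\<And>a. e a \<in> carrier G"
    and rel: "\<And>w. e (Inl w) = word_value G e (comm_block w [0..<k w])"
  obtains \<phi> where "\<phi> \<in> hom (telescope k) G" "\<And>a. \<phi> (telescope_gen k a) = e a"
proof -
  have eU: "e \<in> UNIV \<rightarrow> carrier G" using e by blast
  have exp: "word_value G e (expand k n a) = e a" for n a
    using e by (cases a) (auto simp: expand_def rel[symmetric])
  have unf: "word_value G e (unfold_word k n u) = word_value G e u" for n u
  proof (induction n)
    case (Suc n)
    have "word_value G e (subst_word (expand k n) v) = word_value G e v" for v
      using word_value_subst_word[OF eU, of "expand k n" UNIV v] by (simp add: exp)
    with Suc show ?case by simp
  qed simp
  have red: "word_value G e (reduce w) = word_value G e w" for w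
    using word_value_reduce[OF eU, of w] by simp
  have "word_value G e u = word_value G e v" if uv: "(u, v) \<in> telescope_relations k" for u v
  proof -
    obtain n where "reduce (unfold_word k n u) = reduce (unfold_word k n v)"
      using uv unfolding telescope_relations_iff by blast
    then show ?thesis using red[of "unfold_word k n u"] red[of "unfold_word k n v"] unf by simp
  qed
  moreover have "signed G e l \<in> carrier G" for l using e by (simp add: signed_def)
  ultimately obtain \<phi> where "\<phi> \<in> hom (telescope k) G"
    "\<And>w. \<phi> (word_class (telescope_relations k) w) = word_value G e w"
    using presented_monoid_hom[of "signed G e" "telescope_relations k" UNIV]
    unfolding telescope_def by blast
  with e show thesis by (intro that[of \<phi>]) (auto simp: telescope_gen_def)
qed

text \<open>The first m substitutions touch only letters \<open>Inl w\<close> with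
  \<open>length w < m\<close>.\<close>

lemma unfold_word_id:
  "u \<in> lists (nodes_between n N \<times> UNIV) \<Longrightarrow> m \<le> n \<Longrightarrow> unfold_word k m u = u"
proof (induction m)
  case (Suc m)
  have "subst_word (expand k m) u = u"
    using Suc.prems
  proof (induction u)
    case (Cons l u)
    then have "subst_letter (expand k m) l = [l]"
      by (cases l) (auto simp: nodes_between_def subst_letter_def expand_def)
    with Cons show ?case by simp
  qed simp
  with Suc show ?case by simp
qed simp

lemma comm_block_in_lists:
  "comm_block w js \<in> lists (nodes_between (Suc (length w)) (Suc (length w)) \<times> UNIV)"
  by (induction js) (auto simp: comm_word_def nodes_between_def)

lemma nodes_between_mono: "n' \<le> n \<Longrightarrow> N \<le> N' \<Longrightarrow> nodes_between n N \<subseteq> nodes_between n' N'"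
  by (auto simp: nodes_between_def)

lemma expand_in_lists:
  assumes "n \<le> N" "Suc n \<le> M" "N \<le> M"
  shows "expand k n \<in> nodes_between n N \<rightarrow> lists (nodes_between (Suc n) M \<times> UNIV)"
proof
  fix a assume a: "a \<in> nodes_between n N"
  show "expand k n a \<in> lists (nodes_between (Suc n) M \<times> UNIV)"
  proof (cases "\<exists>w. a = Inl w \<and> length w = n")
    case True
    then obtain w where w: "a = Inl w" "length w = n" by blast
    have "lists (nodes_between (Suc n) (Suc n) \<times> (UNIV :: bool set)) \<subseteq> lists (nodes_between (Suc n) M \<times> UNIV)"
      using nodes_between_mono[of "Suc n" "Suc n" "Suc n" M] assms by (intro lists_mono) auto
    then show ?thesis using comm_block_in_lists[of w] w by (auto simp: expand_def)
  next
    case False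
    with a assms show ?thesis by (auto simp: expand_def nodes_between_def split: sum.splits)
  qed
qed

lemma unfold_word_in_lists:
  "u \<in> lists (nodes_between 0 N \<times> UNIV) \<Longrightarrow> n \<le> N \<Longrightarrow>
     unfold_word k n u \<in> lists (nodes_between n N \<times> UNIV)"
proof (induction n)
  case (Suc n)
  then show ?case using subst_word_in_lists[OF expand_in_lists[of n N N]] by simp
qed simp

section \<open>Embedding the free stages in the telescope\<close>

context
  fixes k :: "nat list \<Rightarrow> nat"
  assumes k_pos: "\<And>w. 0 < k w"
begin

text \<open>The end letters carry the vertex w as a prefix, and swapping or inverting them reveals
  the sign of the block; this excludes cancellation between blocks.\<close>

lemma comm_block_upt:
  "comm_block w [0..<k w] \<noteq> []"
  "hd (comm_block w [0..<k w]) = (Inl (w @ [0]), True)"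
  "last (comm_block w [0..<k w]) = (Inr (w @ [k w - 1]), False)"
  "reduced (comm_block w [0..<k w])"
proof -
  have upt: "[0..<k w] = 0 # [1..<k w]" "[0..<k w] = [0..<k w - 1] @ [k w - 1]"
    using k_pos[of w] upt_conv_Cons[of 0 "k w"] upt_Suc_append[of 0 "k w - 1"] by simp_all
  show "comm_block w [0..<k w] \<noteq> []" "hd (comm_block w [0..<k w]) = (Inl (w @ [0]), True)"
    unfolding upt(1) by (simp_all add: comm_word_def)
  show "last (comm_block w [0..<k w]) = (Inr (w @ [k w - 1]), False)"
    unfolding upt(2) by (simp add: comm_word_def)
  have "reduced (comm_block w js) \<and> (js = [] \<or> (\<exists>v. hd (comm_block w js) = (Inl v, True)))" for js
    by (induction js) (auto simp: comm_word_def reduced_Cons)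
  then show "reduced (comm_block w [0..<k w])" by blast
qed

text \<open>At a seam, fresh letters have length one more than all old \<open>Inr\<close> letters,
  and two blocks can cancel only if they belong to the same vertex with opposite signs, that is, if
  the original letters cancelled. The level is N + m because the first N substitutions fix words of
  stage N.\<close>

lemma unfold_word_reduced:
  assumes w: "reduced w" "w \<in> lists (nodes_between N N \<times> UNIV)"
  shows "reduced (unfold_word k (N + m) w) \<and> (unfold_word k (N + m) w = [] \<longleftrightarrow> w = []) \<and>
    unfold_word k (N + m) w \<in> lists (nodes_between (N + m) (N + m) \<times> UNIV)"
proof (induction m)
  case 0
  show ?case using w unfold_word_id[OF w(2)] by simp
next
  case (Suc m)
  let ?n = "N + m" and ?s = "expand k (N + m)"
  let ?A = "nodes_between ?n ?n \<times> (UNIV :: bool set)"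
  have hd_inv: "hd (word_inv u) = letter_inv (last u)" "last (word_inv u) = letter_inv (hd u)"
    if "u \<noteq> []" for u :: "node word"
    using that by (simp_all add: word_inv_def hd_rev last_rev last_map hd_map)
  have s: "(\<exists>w. l = (Inl w, True) \<and> length w = ?n \<and> subst_letter ?s l = comm_block w [0..<k w]) \<or>
      (\<exists>w. l = (Inl w, False) \<and> length w = ?n \<and> subst_letter ?s l = word_inv (comm_block w [0..<k w])) \<or>
      (\<exists>w b. l = (Inr w, b) \<and> length w \<le> ?n \<and> subst_letter ?s l = [l])" if "l \<in> ?A" for l
    using that by (cases l) (auto simp: nodes_between_def subst_letter_def expand_def)
  have ne: "subst_letter ?s l \<noteq> [] \<and> reduced (subst_letter ?s l)" if "l \<in> ?A" for l
    using s[OF that] by (elim disjE exE conjE; simp add: comm_block_upt reduced_word_inv reduced_Cons)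
  have ends: "hd (subst_letter ?s m) \<noteq> letter_inv (last (subst_letter ?s l))"
    if "l \<in> ?A" "m \<in> ?A" "m \<noteq> letter_inv l" for l m
    using s[OF that(1)] s[OF that(2)] that(3)
    by (elim disjE exE conjE; auto simp: comm_block_upt hd_inv)
  have "subst_word ?s (unfold_word k ?n w) \<in> lists (nodes_between (Suc ?n) (Suc ?n) \<times> UNIV)"
    using Suc by (intro subst_word_in_lists[OF expand_in_lists]) auto
  with Suc reduced_subst_word[of ?A ?s, OF ne ends] subst_word_eq_Nil[of ?A ?s] ne show ?case
    by simp
qed

lemma free_family_telescope:
  "free_family (telescope k) (nodes_between N N) (telescope_gen k)"
  unfolding free_family_def
proof (intro conjI ballI impI telescope_gen_funcset)
  fix w :: "node word"
  assume w: "w \<in> lists (nodes_between N N \<times> UNIV)"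
    "reduced w \<and> word_value (telescope k) (telescope_gen k) w = \<one>\<^bsub>telescope k\<^esub>"
  then have "(w, []) \<in> telescope_relations k"
    by (simp add: word_value_telescope_gen telescope_simps word_class_eq_iff word_eq_telescope)
  then obtain n where "reduce (unfold_word k n w) = reduce (unfold_word k n [])"
    unfolding telescope_relations_iff by blast
  \<comment> \<open>The level witnessing triviality may be below N; raising it to N + n puts it in
    the range of \<open>unfold_word_reduced\<close>.\<close>
  then have "reduce (unfold_word k (N + n) w) = []"
    using reduce_unfold_word_mono[of k n w "[]" "N + n"] by simp
  with unfold_word_reduced[of w N n] w show "w = []" by (simp add: reduce_reduced)
qed

text \<open>Unfolding N times, with N the greatest depth of an occurring letter, rewrites all
  representatives in the basis of stage N without changing their classes.\<close>

lemma finite_subset_telescope: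
  assumes "finite S" "S \<subseteq> carrier (telescope k)"
  shows "\<exists>N. S \<subseteq> generate (telescope k) (telescope_gen k ` nodes_between N N)"
proof -
  interpret T: group "telescope k" by (rule group_telescope)
  from assms obtain U where U: "finite U" "S = word_class (telescope_relations k) ` U"
    unfolding telescope_simps using finite_subset_image by metis
  \<comment> \<open>The inserted 0 keeps \<open>Max\<close> defined when there are no letters at
    all.\<close>
  define N where "N = Max (insert 0 ((case_sum length length \<circ> fst) ` (\<Union>u \<in> U. set u)))"
  have N: "case_sum length length (fst l) \<le> N" if "u \<in> U" "l \<in> set u" for u l
    unfolding N_def using that U(1) by (intro Max_ge) auto
  have "word_class (telescope_relations k) u \<in>
      generate (telescope k) (telescope_gen k ` nodes_between N N)" if u: "u \<in> U" for u
  proof -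
    have "l \<in> nodes_between 0 N \<times> UNIV" if "l \<in> set u" for l
      using N[OF u that] by (cases l; cases "fst l") (auto simp: nodes_between_def)
    then have "u \<in> lists (nodes_between 0 N \<times> UNIV)" by (auto intro: in_listsI)
    then have v: "unfold_word k N u \<in> lists (nodes_between N N \<times> UNIV)"
      by (rule unfold_word_in_lists) simp
    have "word_class (telescope_relations k) u = word_class (telescope_relations k) (unfold_word k N u)"
      by (rule word_class_telescope_eq[of k N]) (simp add: unfold_word_id[OF v])
    with v show ?thesis
      unfolding T.generate_image_eq_word_values[OF telescope_gen_funcset] word_value_telescope_gen
      by blast
  qed
  then show ?thesis unfolding U(2) by blast
qed

end

text \<open>All tree letters are treated at once: each is a product of commutators whose first
  entries are again tree letters, so their normal closure lies in its commutator subgroup with the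
  telescope.\<close>

lemma telescope_gen_in_Gamma: "telescope_gen k (Inl w) \<in> Gamma (telescope k)"
proof -
  let ?T = "telescope k" and ?S = "range (\<lambda>w. telescope_gen k (Inl w))"
  let ?K = "commutator_subgroup ?T (normal_closure ?T ?S) (carrier ?T)"
  interpret T: group ?T by (rule group_telescope)
  have N: "normal_closure ?T ?S \<lhd> ?T" by (rule T.normal_normal_closure) auto
  then have K: "subgroup ?K ?T"
    by (intro T.subgroup_commutator_subgroup) (auto dest: normal_imp_subgroup subgroup.subset)
  have "telescope_gen k (Inl w) \<in> ?K" for w
  proof -
    have "word_value ?T (telescope_gen k) (comm_block w js) \<in> ?K" for js
    proof (induction js)
      case Nil
      then show ?case using subgroup.one_closed[OF K] by simp
    next
      case (Cons j js)
      have "telescope_gen k (Inl (w @ [j])) \<in> normal_closure ?T ?S"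
        by (intro subsetD[OF T.subset_normal_closure[of ?S]] rangeI)
      from T.commutator_in_commutator_subgroup[OF this, of "telescope_gen k (Inr (w @ [j]))" "carrier ?T"]
      have c: "word_value ?T (telescope_gen k) (comm_word (Inl (w @ [j])) (Inr (w @ [j]))) \<in> ?K"
        by (simp add: comm_word_def T.m_assoc)
      have "word_value ?T (telescope_gen k) (comm_block w (j # js)) =
          word_value ?T (telescope_gen k) (comm_word (Inl (w @ [j])) (Inr (w @ [j])))
            \<otimes>\<^bsub>?T\<^esub> word_value ?T (telescope_gen k) (comm_block w js)"
        unfolding comm_block_simps
        by (rule T.word_value_append[OF telescope_gen_funcset[of k UNIV]]) simp_all
      then show ?case using subgroup.m_closed[OF K c Cons.IH] by (simp only:)
    qed
    moreover have "telescope_gen k (Inl w) =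
        word_class (telescope_relations k) (comm_block w [0..<k w])"
      unfolding telescope_gen_def
    \<comment> \<open>The first level at which \<open>Inl w\<close> has been replaced; its children
      are still intact there.\<close>
    proof (rule word_class_telescope_eq[of k "Suc (length w)"])
      have "unfold_word k (length w) [(Inl w, True)] = [(Inl w, True)]"
        by (rule unfold_word_id[of _ "length w" "length w"]) (auto simp: nodes_between_def)
      then have "unfold_word k (Suc (length w)) [(Inl w, True)] = comm_block w [0..<k w]"
        by (simp add: subst_letter_def expand_def)
      moreover have "unfold_word k (Suc (length w)) (comm_block w [0..<k w]) = comm_block w [0..<k w]"
        by (rule unfold_word_id[OF comm_block_in_lists]) simp
      ultimately show "reduce (unfold_word k (Suc (length w)) [(Inl w, True)]) =
          reduce (unfold_word k (Suc (length w)) (comm_block w [0..<k w]))"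
        by (simp only:)
    qed
    ultimately show ?thesis by (simp add: word_value_telescope_gen)
  qed
  then have "?S \<subseteq> Gamma ?T"
    by (intro T.subset_Gamma_via_normal_closure) auto
  then show ?thesis by blast
qed

lemma (in group) Gamma_from_telescope:
  assumes x: "x \<in> Gamma G"
  obtains k \<phi> where "\<And>w. 0 < k w" "\<phi> \<in> hom (telescope k) G" "\<phi> (telescope_gen k (Inl [])) = x"
proof -
  let ?c = "\<lambda>(a, b). a \<otimes> b \<otimes> inv a \<otimes> inv b"
  define ps where "ps y = (SOME ps. ps \<in> lists (Gamma G \<times> carrier G) \<and> ps \<noteq> [] \<and>
    y = list_prod G ?c ps)" for y
  have sub: "subgroup (Gamma G) G" using Gamma_normal by (rule normal_imp_subgroup)
  have "ps y \<in> lists (Gamma G \<times> carrier G) \<and> ps y \<noteq> [] \<and> y = list_prod G ?c (ps y)"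
    if "y \<in> Gamma G" for y
    unfolding ps_def
  proof (rule someI_ex)
    have "y \<in> commutator_subgroup G (Gamma G) (carrier G)"
      using that Gamma_eq_commutator_subgroup by simp
    from commutator_subgroup_list_prod[OF Gamma_normal this]
    show "\<exists>ps. ps \<in> lists (Gamma G \<times> carrier G) \<and> ps \<noteq> [] \<and> y = list_prod G ?c ps" by blast
  qed
  then have ps: "ps y \<in> lists (Gamma G \<times> carrier G)" "ps y \<noteq> []" "list_prod G ?c (ps y) = y"
    if "y \<in> Gamma G" for y using that by simp_all
  have nth: "fst (ps y ! j) \<in> Gamma G" "snd (ps y ! j) \<in> carrier G"
    if "y \<in> Gamma G" "j < length (ps y)" for y j
    using in_listsD[OF ps(1)[OF that(1)]] that(2) by (auto simp: mem_Times_iff)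
  \<comment> \<open>The tree of first entries, rooted at x. The default keeps every vertex in
    \<open>Gamma G\<close>; positions beyond the list never enter a relation.\<close>
  define h where "h = foldl (\<lambda>y j. if j < length (ps y) then fst (ps y ! j) else \<one>) x"
  \<comment> \<open>The second entries, arbitrary in G. At the empty list \<open>last\<close> is
    unspecified, but the length test still keeps the value in the carrier.\<close>
  define g where "g w = (let y = h (butlast w) in
    if last w < length (ps y) then snd (ps y ! last w) else \<one>)" for w
  define k where "k w = length (ps (h w))" for w
  define e where "e = case_sum h g"
  have h: "h w \<in> Gamma G" for w
  proof (induction w rule: rev_induct)
    case Nil
    then show ?case using x by (simp add: h_def)
  next
    case (snoc j w)
    then show ?case using nth(1)[of "h w" j] subgroup.one_closed[OF sub] by (simp add: h_def)
  qed
  have e: "e a \<in> carrier G" for a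
    using h subgroup.mem_carrier[OF sub] nth(2)[OF h]
    by (cases a) (simp_all add: e_def g_def Let_def)
  then have eU: "e \<in> UNIV \<rightarrow> carrier G" by blast
  have val: "word_value G e (comm_block w js) =
      list_prod G (\<lambda>j. ?c (h (w @ [j]), g (w @ [j]))) js" for w js
  proof (induction js)
    case (Cons j js)
    have "h (w @ [j]) \<in> carrier G" "g (w @ [j]) \<in> carrier G"
      "word_value G e (comm_block w js) \<in> carrier G"
      using e[of "Inl (w @ [j])"] e[of "Inr (w @ [j])"] word_value_closed[OF eU]
      by (simp_all add: e_def)
    with Cons show ?case by (simp add: comm_word_def e_def m_assoc)
  qed simp
  have "h w = word_value G e (comm_block w [0..<k w])" for w
  proof -
    have "list_prod G f (map r js) = list_prod G (\<lambda>j. f (r j)) js"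
      for f :: "'a \<times> 'a \<Rightarrow> 'a" and r and js :: "nat list"
      by (induction js) simp_all
    from this[of ?c "\<lambda>j. ps (h w) ! j" "[0..<k w]"]
    have "h w = list_prod G (\<lambda>j. ?c (ps (h w) ! j)) [0..<k w]"
      using ps(3)[OF h, of w] by (simp add: k_def map_nth)
    also have "\<dots> = list_prod G (\<lambda>j. ?c (h (w @ [j]), g (w @ [j]))) [0..<k w]"
      by (rule list_prod_cong) (auto simp: k_def h_def g_def case_prod_unfold)
    finally show ?thesis by (simp add: val)
  qed
  then have "e (Inl w) = word_value G e (comm_block w [0..<k w])" for w by (simp add: e_def)
  from telescope_hom[of e k, OF e this] obtain \<phi>
    where \<phi>: "\<phi> \<in> hom (telescope k) G" "\<And>a. \<phi> (telescope_gen k a) = e a" by blast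
  have "\<phi> (telescope_gen k (Inl [])) = x" by (simp add: \<phi> e_def h_def)
  moreover have "0 < k w" for w using ps(2)[OF h, of w] by (simp add: k_def)
  ultimately show thesis using that \<phi>(1) by blast
qed

section \<open>Transport to groups on the natural numbers\<close>

lemma locally_free_isoI:
  fixes f :: "'a \<Rightarrow> 'b"
  assumes "f \<in> iso G H" "group G" "group H"
    and fam: "\<And>S. finite S \<Longrightarrow> S \<subseteq> carrier G \<Longrightarrow>
      \<exists>I (x :: 'i \<Rightarrow> 'a). free_family G I x \<and> S \<subseteq> generate G (x ` I)"
  shows "locally_free H"
proof (rule group.locally_freeI[OF \<open>group H\<close>])
  interpret f: group_hom G H f
    using assms by (simp add: group_hom_def group_hom_axioms_def iso_iff)
  have inj: "inj_on f (carrier G)" and surj: "f ` carrier G = carrier H"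
    using assms(1) by (simp_all add: iso_iff)
  fix S assume "finite S" "S \<subseteq> carrier H"
  then obtain S' where S': "S' \<subseteq> carrier G" "finite S'" "S = f ` S'"
    unfolding surj[symmetric] by (metis finite_subset_image)
  then obtain I and x :: "'i \<Rightarrow> 'a" where x: "free_family G I x" "S' \<subseteq> generate G (x ` I)"
    using fam by blast
  have xc: "x \<in> I \<rightarrow> carrier G" using x(1) by (simp add: free_family_def)
  have "w = []" if w: "w \<in> lists (I \<times> UNIV)" "reduced w"
    "word_value H (\<lambda>i. f (x i)) w = \<one>\<^bsub>H\<^esub>" for w
  proof -
    have "f (word_value G x w) = word_value H (\<lambda>i. f (x i)) w"
      unfolding f.hom_list_prod[OF f.G.signed_in_carrier[OF xc] w(1)]
      using w(1) xc by (intro list_prod_cong) (auto simp: signed_def Pi_iff dest!: in_listsD)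
    with w have "f (word_value G x w) = f \<one>\<^bsub>G\<^esub>" by simp
    then have "word_value G x w = \<one>\<^bsub>G\<^esub>"
      by (rule inj_onD[OF inj]) (simp_all add: f.G.word_value_closed[OF xc w(1)])
    with x(1) w show ?thesis by (simp add: free_family_def)
  qed
  then have "free_family H I (\<lambda>i. f (x i))" using xc by (auto simp: free_family_def Pi_iff)
  moreover have "S \<subseteq> generate H ((\<lambda>i. f (x i)) ` I)"
    using f.generate_img[of "x ` I"] x(2) xc S'(3)
    by (simp add: image_image image_mono flip: image_subset_iff_funcset)
  ultimately show "\<exists>I (x :: 'i \<Rightarrow> 'b). free_family H I x \<and> S \<subseteq> generate H (x ` I)" by blast
qed

lemma (in group) iso_image_group:
  assumes "inj_on f (carrier G)"
  shows "f \<in> iso G (image_group f G)" "group (image_group f G)"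
proof -
  show *: "f \<in> iso G (image_group f G)"
    using assms by (auto simp: image_group_def iso_iff hom_def)
  have "group ((image_group f G)\<lparr>one := f \<one>\<rparr>)" by (rule iso_imp_img_group[OF *])
  then show "group (image_group f G)" by (simp add: image_group_def)
qed

text \<open>The telescope is copied to the type nat because
  \<open>countable_locally_free_reps\<close> guarantees representatives for groups over that
  type.\<close>

theorem (in group) Gamma_from_countable_locally_free:
  assumes "x \<in> Gamma G"
  obtains D :: "nat monoid" and \<phi> where "locally_free D" "\<phi> \<in> hom D G" "x \<in> \<phi> ` Gamma D"
proof -
  obtain k \<phi> where k: "\<And>w. 0 < k w"
    and \<phi>: "\<phi> \<in> hom (telescope k) G" "\<phi> (telescope_gen k (Inl [])) = x"
    using Gamma_from_telescope[OF assms] by blast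
  let ?T = "telescope k" let ?f = "to_nat_on (carrier ?T)" let ?D = "image_group ?f ?T"
  interpret T: group ?T by (rule group_telescope)
  have "countable (carrier ?T)" by (simp add: telescope_simps)
  then have "inj_on ?f (carrier ?T)" by (rule inj_on_to_nat_on)
  note f = T.iso_image_group[OF this]
  interpret D: group ?D by (rule f(2))
  have g: "inv_into (carrier ?T) ?f \<in> iso ?D ?T" by (rule T.iso_set_sym[OF f(1)])
  show thesis
  proof (rule that)
    show "locally_free ?D"
    proof (rule locally_free_isoI[OF f(1) T.is_group f(2)])
      fix S assume "finite S" "S \<subseteq> carrier ?T"
      then obtain N where "S \<subseteq> generate ?T (telescope_gen k ` nodes_between N N)"
        using finite_subset_telescope[of k S] k by blast
      with free_family_telescope[of k N] k
      show "\<exists>I (x :: node \<Rightarrow> _). free_family ?T I x \<and> S \<subseteq> generate ?T (x ` I)" by blast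
    qed
    show "\<phi> \<circ> inv_into (carrier ?T) ?f \<in> hom ?D G"
      using g \<phi>(1) by (auto simp: iso_def intro: Group.hom_compose)
    interpret f: group_hom ?T ?D ?f
      using f by (simp add: group_hom_def group_hom_axioms_def iso_def T.is_group)
    have "?f (telescope_gen k (Inl [])) \<in> Gamma ?D"
      using f.image_Gamma_subset telescope_gen_in_Gamma by blast
    moreover have "x = (\<phi> \<circ> inv_into (carrier ?T) ?f) (?f (telescope_gen k (Inl [])))"
      using \<phi>(2) \<open>inj_on ?f (carrier ?T)\<close> by simp
    ultimately show "x \<in> (\<phi> \<circ> inv_into (carrier ?T) ?f) ` Gamma ?D" by blast
  qed
qed


section \<open>Free products\<close>

context
  fixes I :: "'i set" and G :: "'i \<Rightarrow> 'a monoid"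
  assumes grp: "\<And>i. i \<in> I \<Longrightarrow> group (G i)"
begin

lemma group_free_product: "group (free_product I G)"
  unfolding free_product_def
proof (rule group_presented_monoid)
  let ?R = "free_product_relations I G"
  fix l assume "l \<in> (SIGMA i:I. carrier (G i))"
  then obtain i x where l: "l = (i, x)" "i \<in> I" "x \<in> carrier (G i)" by blast
  interpret Gi: group "G i" by (rule grp) fact
  let ?y = "inv\<^bsub>G i\<^esub> x"
  have "([(i, ?y), (i, x)], [(i, \<one>\<^bsub>G i\<^esub>)]) \<in> ?R"
    using l by (force simp: free_product_relations_def)
  moreover have "([(i, \<one>\<^bsub>G i\<^esub>)], []) \<in> ?R" using l by (simp add: free_product_relations_def)
  ultimately have "word_eq ?R [(i, ?y), (i, x)] []"
    using word_eq.relator[of _ _ ?R "[]" "[]"] by (auto intro: word_eq.trans)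
  then show "\<exists>w \<in> lists (SIGMA i:I. carrier (G i)). word_eq ?R (w @ [l]) []"
    using l by (intro bexI[of _ "[(i, ?y)]"]) auto
qed

lemma free_product_incl_hom:
  assumes "i \<in> I"
  shows "free_product_incl I G i \<in> hom (G i) (free_product I G)"
proof (rule homI)
  fix x y assume xy: "x \<in> carrier (G i)" "y \<in> carrier (G i)"
  show "free_product_incl I G i x \<in> carrier (free_product I G)"
    using assms xy unfolding free_product_incl_def free_product_def carrier_presented_monoid
    by (intro imageI) simp
  have "([(i, x), (i, y)], [(i, x \<otimes>\<^bsub>G i\<^esub> y)]) \<in> free_product_relations I G"
    using assms xy by (auto simp: free_product_relations_def)
  from word_eq.relator[OF this, of "[]" "[]"]
  show "free_product_incl I G i (x \<otimes>\<^bsub>G i\<^esub> y) =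
      free_product_incl I G i x \<otimes>\<^bsub>free_product I G\<^esub> free_product_incl I G i y"
    by (simp add: free_product_incl_def free_product_def mult_presented_monoid word_class_eq_iff
        word_eq.sym)
qed

lemma free_product_lift:
  fixes H :: "('h, 'm) monoid_scheme"
  assumes H: "group H" and \<phi>: "\<And>i. i \<in> I \<Longrightarrow> \<phi> i \<in> hom (G i) H"
  obtains \<Phi> where "\<Phi> \<in> hom (free_product I G) H"
    and "\<And>i x. i \<in> I \<Longrightarrow> x \<in> carrier (G i) \<Longrightarrow> \<Phi> (free_product_incl I G i x) = \<phi> i x"
proof -
  interpret H: group H by fact
  \<comment> \<open>Identity outside the alphabet, again to have a value for every letter of the
    type.\<close>
  define e where "e = (\<lambda>(i, x). if i \<in> I \<and> x \<in> carrier (G i) then \<phi> i x else \<one>\<^bsub>H\<^esub>)"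
  have hom: "group_hom (G i) H (\<phi> i)" if "i \<in> I" for i
    using that grp \<phi> H by (simp add: group_hom_def group_hom_axioms_def)
  have e: "e l \<in> carrier H" for l
    using group_hom.hom_closed[OF hom] by (auto simp: e_def split: prod.splits)
  have "list_prod H e u = list_prod H e v" if uv: "(u, v) \<in> free_product_relations I G" for u v
    using uv group_hom.hom_one[OF hom] group_hom.hom_mult[OF hom] group_hom.hom_closed[OF hom]
      group.is_monoid[OF grp, THEN monoid.m_closed] group.is_monoid[OF grp, THEN monoid.one_closed]
    by (auto simp: free_product_relations_def e_def)
  from H.presented_monoid_hom[of e "free_product_relations I G" "SIGMA i:I. carrier (G i)", OF e this]
  obtain \<Phi> where "\<Phi> \<in> hom (free_product I G) H"
    "\<And>w. \<Phi> (word_class (free_product_relations I G) w) = list_prod H e w"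
    unfolding free_product_def by blast
  then show thesis
    using e by (intro that[of \<Phi>]) (auto simp: free_product_incl_def e_def group_hom.hom_closed[OF hom])
qed

end

section \<open>Local groups and localizations\<close>

lemma compose_in_Hom:
  "group G \<Longrightarrow> \<phi> \<in> Hom G H \<Longrightarrow> \<psi> \<in> Hom H K \<Longrightarrow> compose (carrier G) \<psi> \<phi> \<in> Hom G K"
  by (auto simp: Hom_def intro: group.hom_compose)

lemma compose_eqD:
  "compose A \<psi> \<phi> = compose A \<psi>' \<phi>' \<Longrightarrow> x \<in> A \<Longrightarrow> \<psi> (\<phi> x) = \<psi>' (\<phi>' x)"
  by (metis compose_eq)

lemma HomD:
  assumes "\<phi> \<in> Hom G H"
  shows "\<phi> \<in> hom G H" "\<phi> \<in> extensional (carrier G)" "x \<in> carrier G \<Longrightarrow> \<phi> x \<in> carrier H"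
  using assms by (auto simp: Hom_def hom_def)

lemma Hom_eqI:
  "\<phi> \<in> Hom G H \<Longrightarrow> \<psi> \<in> Hom G H' \<Longrightarrow> (\<And>x. x \<in> carrier G \<Longrightarrow> \<phi> x = \<psi> x) \<Longrightarrow> \<phi> = \<psi>"
  by (blast intro: extensionalityI dest: HomD(2))

lemma restrict_in_Hom: "group G \<Longrightarrow> \<phi> \<in> hom G H \<Longrightarrow> restrict \<phi> (carrier G) \<in> Hom G H"
  by (auto simp: Hom_def hom_def group.is_monoid monoid.m_closed)

lemma Hom_factor_surjection:
  assumes A: "group A" and B: "group B" and G: "group G" and l: "l \<in> Hom A B"
    and surj: "l ` carrier A = carrier B"
    and \<phi>: "\<phi> \<in> Hom A G" and ker: "\<And>x. x \<in> kernel A B l \<Longrightarrow> \<phi> x = \<one>\<^bsub>G\<^esub>"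
  shows "\<exists>!\<psi>. \<psi> \<in> Hom B G \<and> compose (carrier A) \<psi> l = \<phi>"
proof (rule ex_ex1I)
  interpret l: group_hom A B l
    using A B HomD(1)[OF l] by (simp add: group_hom_def group_hom_axioms_def)
  interpret \<phi>: group_hom A G \<phi>
    using A G HomD(1)[OF \<phi>] by (simp add: group_hom_def group_hom_axioms_def)
  have eq: "\<phi> x = \<phi> y" if "x \<in> carrier A" "y \<in> carrier A" "l x = l y" for x y
  proof -
    have "x \<otimes>\<^bsub>A\<^esub> inv\<^bsub>A\<^esub> y \<in> kernel A B l" using that by (simp add: kernel_def)
    from ker[OF this] have "\<phi> x \<otimes>\<^bsub>G\<^esub> inv\<^bsub>G\<^esub> (\<phi> y) = \<one>\<^bsub>G\<^esub>" using that by simp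
    then show ?thesis using that by (metis \<phi>.H.inv_equality \<phi>.H.inv_inv \<phi>.H.inv_closed \<phi>.hom_closed)
  qed
  define s where "s = inv_into (carrier A) l"
  have s: "s b \<in> carrier A" "l (s b) = b" if "b \<in> carrier B" for b
    using that unfolding s_def surj[symmetric] by (auto intro: inv_into_into f_inv_into_f)
  define \<psi> where "\<psi> = (\<lambda>b \<in> carrier B. \<phi> (s b))"
  have \<psi>: "\<psi> (l x) = \<phi> x" if "x \<in> carrier A" for x
    using that s[of "l x"] eq[of "s (l x)" x] by (simp add: \<psi>_def)
  have "\<psi> \<in> hom B G"
  proof (rule homI)
    fix b c assume bc: "b \<in> carrier B" "c \<in> carrier B"
    then show "\<psi> b \<in> carrier G" using s by (simp add: \<psi>_def)
    have "\<psi> (b \<otimes>\<^bsub>B\<^esub> c) = \<psi> (l (s b \<otimes>\<^bsub>A\<^esub> s c))" using s bc by simp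
    also have "\<dots> = \<psi> b \<otimes>\<^bsub>G\<^esub> \<psi> c" using s bc by (subst \<psi>) (simp_all add: \<psi>_def)
    finally show "\<psi> (b \<otimes>\<^bsub>B\<^esub> c) = \<psi> b \<otimes>\<^bsub>G\<^esub> \<psi> c" .
  qed
  then have "\<psi> \<in> Hom B G" by (simp add: Hom_def \<psi>_def)
  moreover from this have "compose (carrier A) \<psi> l = \<phi>"
    by (intro Hom_eqI[OF compose_in_Hom[OF A l] \<phi>]) (simp_all add: compose_eq \<psi>)
  ultimately show "\<exists>\<psi>. \<psi> \<in> Hom B G \<and> compose (carrier A) \<psi> l = \<phi>" by blast
next
  fix \<psi> \<psi>' assume *: "\<psi> \<in> Hom B G \<and> compose (carrier A) \<psi> l = \<phi>"
    "\<psi>' \<in> Hom B G \<and> compose (carrier A) \<psi>' l = \<phi>"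
  show "\<psi> = \<psi>'"
  proof (rule Hom_eqI)
    fix b assume "b \<in> carrier B"
    then obtain a where "a \<in> carrier A" "b = l a" using surj by blast
    then show "\<psi> b = \<psi>' b" using * by (metis compose_eq)
  qed (use * in blast)+
qed

lemma quotient_map_props:
  assumes "N \<lhd> G"
  shows "quotient_map G N \<in> Hom G (G Mod N)"
    and "quotient_map G N ` carrier G = carrier (G Mod N)"
    and "kernel G (G Mod N) (quotient_map G N) = N"
proof -
  interpret N: normal N G by fact
  show "quotient_map G N \<in> Hom G (G Mod N)"
    unfolding quotient_map_def by (rule restrict_in_Hom[OF N.is_group N.r_coset_hom_Mod])
  show "quotient_map G N ` carrier G = carrier (G Mod N)"
    by (simp add: quotient_map_def carrier_FactGroup)
  have "x \<in> N \<longleftrightarrow> N #>\<^bsub>G\<^esub> x = N" if "x \<in> carrier G" for x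
    using that N.coset_join1[OF _ _ N.subgroup_axioms] N.rcos_const[OF N.is_group] by blast
  then show "kernel G (G Mod N) (quotient_map G N) = N"
    using N.subset by (auto simp: kernel_def quotient_map_def)
qed

text \<open>Precomposition with a surjection is always injective, so locality only says that every
  homomorphism from A factors through the quotient.\<close>

lemma local_group_quotient_map_iff:
  assumes A: "group A" and N: "N \<lhd> A"
  shows "local_group A (A Mod N) (quotient_map A N) G \<longleftrightarrow>
    group G \<and> (\<forall>\<phi> \<in> hom A G. \<forall>x \<in> N. \<phi> x = \<one>\<^bsub>G\<^esub>)"
proof (cases "group G")
  case G: True
  interpret N: normal N A by (rule N)
  let ?q = "quotient_map A N" and ?B = "A Mod N"
  note q = quotient_map_props[OF N]
  show ?thesis
  proof
    assume "local_group A ?B ?q G"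
    then have surj: "(\<lambda>\<phi>. compose (carrier A) \<phi> ?q) ` Hom ?B G = Hom A G"
      by (simp add: local_group_def bij_betw_def)
    have "\<phi> x = \<one>\<^bsub>G\<^esub>" if \<phi>: "\<phi> \<in> hom A G" and x: "x \<in> N" for \<phi> x
    proof -
      have "restrict \<phi> (carrier A) \<in> Hom A G" by (rule restrict_in_Hom[OF A \<phi>])
      then obtain \<psi> where \<psi>: "\<psi> \<in> Hom ?B G" "restrict \<phi> (carrier A) = compose (carrier A) \<psi> ?q"
        unfolding surj[symmetric] by blast
      interpret \<psi>: group_hom ?B G \<psi>
        using \<psi>(1) N.factorgroup_is_group G by (simp add: group_hom_def group_hom_axioms_def Hom_def)
      have "x \<in> kernel A ?B ?q" using x q(3) by simp
      then have "x \<in> carrier A" "?q x = \<one>\<^bsub>?B\<^esub>" by (simp_all add: kernel_def del: one_FactGroup)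
      then show ?thesis using fun_cong[OF \<psi>(2), of x] \<psi>.hom_one by (simp add: compose_eq)
    qed
    with G show "group G \<and> (\<forall>\<phi> \<in> hom A G. \<forall>x \<in> N. \<phi> x = \<one>\<^bsub>G\<^esub>)" by blast
  next
    assume kills: "group G \<and> (\<forall>\<phi> \<in> hom A G. \<forall>x \<in> N. \<phi> x = \<one>\<^bsub>G\<^esub>)"
    have ex1: "\<exists>!\<psi>. \<psi> \<in> Hom ?B G \<and> compose (carrier A) \<psi> ?q = \<phi>" if "\<phi> \<in> Hom A G" for \<phi>
      by (rule Hom_factor_surjection[OF A N.factorgroup_is_group G q(1,2) that])
        (use kills HomD(1)[OF that] q(3) in auto)
    have "bij_betw (\<lambda>\<phi>. compose (carrier A) \<phi> ?q) (Hom ?B G) (Hom A G)"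
    proof (rule bij_betwI')
      fix \<psi> \<psi>' assume *: "\<psi> \<in> Hom ?B G" "\<psi>' \<in> Hom ?B G"
      then show "(compose (carrier A) \<psi> ?q = compose (carrier A) \<psi>' ?q) = (\<psi> = \<psi>')"
        using ex1[OF compose_in_Hom[OF A q(1) *(1)]] by auto
    next
      fix \<psi> assume "\<psi> \<in> Hom ?B G"
      then show "compose (carrier A) \<psi> ?q \<in> Hom A G" by (rule compose_in_Hom[OF A q(1)])
    next
      fix \<phi> assume "\<phi> \<in> Hom A G"
      from ex1[OF this] show "\<exists>\<psi> \<in> Hom ?B G. \<phi> = compose (carrier A) \<psi> ?q" by blast
    qed
    with G show "local_group A ?B ?q G" by (simp add: local_group_def)
  qed
qed (simp add: local_group_def)

section \<open>Localizations as initial maps\<close>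

lemma is_localization_unique:
  fixes H :: "'c monoid"
  assumes G: "group G" and loc: "is_localization TYPE('c) A B f G L l" and H: "local_group A B f H"
    and \<psi>: "\<psi> \<in> Hom L H" "\<psi>' \<in> Hom L H" "\<And>x. x \<in> carrier G \<Longrightarrow> \<psi> (l x) = \<psi>' (l x)"
  shows "\<psi> = \<psi>'"
proof -
  have l: "l \<in> Hom G L" using loc by (simp add: is_localization_def)
  have "compose (carrier G) \<psi> l = compose (carrier G) \<psi>' l"
    using \<psi>(3) by (intro Hom_eqI[OF compose_in_Hom[OF G l \<psi>(1)] compose_in_Hom[OF G l \<psi>(2)]])
      (simp add: compose_eq)
  moreover have "\<exists>!\<chi>. \<chi> \<in> Hom L H \<and> compose (carrier G) \<chi> l = compose (carrier G) \<psi> l"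
    using loc H compose_in_Hom[OF G l \<psi>(1)] unfolding is_localization_def by blast
  ultimately show ?thesis using \<psi>(1,2) by (metis (no_types))
qed

lemma is_localization_extend:
  fixes H :: "'c monoid"
  assumes "is_localization TYPE('c) A B f G L l" "local_group A B f H" "\<phi> \<in> Hom G H"
  obtains \<psi> where "\<psi> \<in> Hom L H" "compose (carrier G) \<psi> l = \<phi>"
  using assms unfolding is_localization_def by blast

text \<open>The usual uniqueness of initial objects. Both targets live over the type 'c used for
  testing, so each can be tested against the other.\<close>

lemma is_localization_iso:
  fixes L L' :: "'c monoid"
  assumes G: "group G" and loc: "is_localization TYPE('c) A B f G L l"
    and loc': "is_localization TYPE('c) A' B' f' G L' l'"
    and same: "local_group A B f L'" "local_group A' B' f' L"
  obtains \<theta> where "\<theta> \<in> iso L L'" "\<theta> \<in> Hom L L'" "\<And>x. x \<in> carrier G \<Longrightarrow> \<theta> (l x) = l' x"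
proof -
  have l: "l \<in> Hom G L" "local_group A B f L" and l': "l' \<in> Hom G L'" "local_group A' B' f' L'"
    using loc loc' by (simp_all add: is_localization_def)
  obtain \<theta> where \<theta>: "\<theta> \<in> Hom L L'" "compose (carrier G) \<theta> l = l'"
    using is_localization_extend[OF loc same(1) l'(1)] by blast
  obtain \<eta> where \<eta>: "\<eta> \<in> Hom L' L" "compose (carrier G) \<eta> l' = l"
    using is_localization_extend[OF loc' same(2) l(1)] by blast
  have \<theta>l: "\<theta> (l x) = l' x" and \<eta>l: "\<eta> (l' x) = l x" if "x \<in> carrier G" for x
    using that \<theta>(2) \<eta>(2) by (metis compose_eq)+
  have id: "(\<lambda>x \<in> carrier K. x) \<in> Hom K K" if "group K" for K :: "'c monoid"
    using restrict_in_Hom[OF that, of "\<lambda>x. x"] by (simp add: hom_def)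
  have grp: "group L" "group L'" using l l' by (simp_all add: local_group_def)
  have "compose (carrier L) \<eta> \<theta> = (\<lambda>x \<in> carrier L. x)"
    using HomD(3)[OF l(1)]
    by (intro is_localization_unique[OF G loc l(2) compose_in_Hom[OF grp(1) \<theta>(1) \<eta>(1)] id[OF grp(1)]])
      (simp add: compose_eq \<theta>l \<eta>l)
  moreover have "compose (carrier L') \<theta> \<eta> = (\<lambda>x \<in> carrier L'. x)"
    using HomD(3)[OF l'(1)]
    by (intro is_localization_unique[OF G loc' l'(2) compose_in_Hom[OF grp(2) \<eta>(1) \<theta>(1)] id[OF grp(2)]])
      (simp add: compose_eq \<theta>l \<eta>l)
  ultimately have inv: "\<eta> (\<theta> x) = x" "\<theta> (\<eta> y) = y" if "x \<in> carrier L" "y \<in> carrier L'" for x y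
    using that by (metis compose_eq restrict_apply')+
  have "bij_betw \<theta> (carrier L) (carrier L')"
    by (rule bij_betw_byWitness[of _ \<eta>]) (use inv grp HomD(3)[OF \<theta>(1)] HomD(3)[OF \<eta>(1)]
      group.is_monoid monoid.one_closed in fast)+
  then have "\<theta> \<in> iso L L'" using HomD(1)[OF \<theta>(1)] by (simp add: iso_def)
  with \<theta>(1) \<theta>l show thesis using that by blast
qed

text \<open>Initiality forces the action on morphisms, and its uniqueness half yields the functor
  laws.\<close>

lemma localization_functor_exists:
  fixes L :: "'u monoid \<Rightarrow> 'u monoid"
  assumes loc: "\<And>G. group G \<Longrightarrow> is_localization TYPE('u) A B f G (L G) (l G)"
  shows "\<exists>L\<^sub>m. localization_functor A B f L L\<^sub>m l"
proof -
  have local: "local_group A B f (L G)" and l: "l G \<in> Hom G (L G)" if "group G" for G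
    using loc[OF that] by (simp_all add: is_localization_def)
  have grp: "group (L G)" if "group G" for G using local[OF that] by (simp add: local_group_def)
  define L\<^sub>m where "L\<^sub>m G H \<phi> = (SOME \<psi>. \<psi> \<in> Hom (L G) (L H) \<and>
    compose (carrier G) \<psi> (l G) = compose (carrier G) (l H) \<phi>)" for G H :: "'u monoid" and \<phi>
  have Lm: "L\<^sub>m G H \<phi> \<in> Hom (L G) (L H) \<and>
      compose (carrier G) (L\<^sub>m G H \<phi>) (l G) = compose (carrier G) (l H) \<phi>"
    if "group G" "group H" "\<phi> \<in> Hom G H" for G H \<phi>
  proof -
    have "\<exists>\<psi>. \<psi> \<in> Hom (L G) (L H) \<and> compose (carrier G) \<psi> (l G) = compose (carrier G) (l H) \<phi>"
      using is_localization_extend[OF loc local compose_in_Hom[OF _ that(3) l]] that by metis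
    from someI_ex[OF this] show ?thesis unfolding L\<^sub>m_def .
  qed
  have Lml: "L\<^sub>m G H \<phi> (l G x) = l H (\<phi> x)"
    if "group G" "group H" "\<phi> \<in> Hom G H" "x \<in> carrier G" for G H \<phi> x
    using Lm[OF that(1-3)] compose_eqD that(4) by metis
  have "group_functor L L\<^sub>m"
    unfolding group_functor_def
  proof (intro conjI allI impI ballI)
    fix G :: "'u monoid" assume G: "group G"
    show "group (L G)" by (rule grp[OF G])
    have id: "(\<lambda>x \<in> carrier K. x) \<in> Hom K K" if "group K" for K :: "'u monoid"
      using restrict_in_Hom[OF that, of "\<lambda>x. x"] by (simp add: hom_def)
    show "L\<^sub>m G G (\<lambda>x \<in> carrier G. x) = (\<lambda>x \<in> carrier (L G). x)"
      using Lm[OF G G id[OF G]] Lml[OF G G id[OF G]] HomD(3)[OF l[OF G]]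
      by (intro is_localization_unique[OF G loc[OF G] local[OF G] _ id[OF grp[OF G]]]) simp_all
  next
    fix G H :: "'u monoid" and \<phi> assume "group G \<and> group H" "\<phi> \<in> Hom G H"
    then show "L\<^sub>m G H \<phi> \<in> Hom (L G) (L H)" using Lm by blast
  next
    fix G H K :: "'u monoid" and \<phi> \<psi>
    assume grps: "group G \<and> group H \<and> group K" and \<phi>: "\<phi> \<in> Hom G H" and \<psi>: "\<psi> \<in> Hom H K"
    then have G: "group G" and H: "group H" and K: "group K" by auto
    note c = compose_in_Hom[OF G \<phi> \<psi>]
    show "L\<^sub>m G K (compose (carrier G) \<psi> \<phi>) = compose (carrier (L G)) (L\<^sub>m H K \<psi>) (L\<^sub>m G H \<phi>)"
    proof (rule is_localization_unique[OF G loc[OF G] local[OF K]])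
      show "L\<^sub>m G K (compose (carrier G) \<psi> \<phi>) \<in> Hom (L G) (L K)" using Lm[OF G K c] by blast
      show "compose (carrier (L G)) (L\<^sub>m H K \<psi>) (L\<^sub>m G H \<phi>) \<in> Hom (L G) (L K)"
        using Lm[OF G H \<phi>] Lm[OF H K \<psi>] grp[OF G] by (blast intro: compose_in_Hom)
      fix x assume "x \<in> carrier G"
      then show "L\<^sub>m G K (compose (carrier G) \<psi> \<phi>) (l G x) =
          compose (carrier (L G)) (L\<^sub>m H K \<psi>) (L\<^sub>m G H \<phi>) (l G x)"
        using HomD(3)[OF l[OF G]] HomD(3)[OF \<phi>]
        by (simp add: compose_eq Lml[OF G K c] Lml[OF G H \<phi>] Lml[OF H K \<psi>])
    qed
  qed
  then have "localization_functor A B f L L\<^sub>m l"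
    using loc Lm by (auto simp: localization_functor_def)
  then show ?thesis by blast
qed

text \<open>Both sides of the naturality square agree after composition with \<open>l G\<close> and
  end in a local group, so uniqueness of extensions makes them equal.\<close>

lemma naturally_equivalentI:
  fixes L L' :: "'u monoid \<Rightarrow> 'u monoid"
  assumes F: "localization_functor A B f L L\<^sub>m l" and F': "localization_functor A' B' f' L' L'\<^sub>m l'"
    and same: "\<And>G :: 'u monoid. local_group A B f G \<longleftrightarrow> local_group A' B' f' G"
  shows "naturally_equivalent L L\<^sub>m L' L'\<^sub>m"
proof -
  have loc: "is_localization TYPE('u) A B f G (L G) (l G)"
    and loc': "is_localization TYPE('u) A' B' f' G (L' G) (l' G)" if "group G" for G
    using F F' that by (simp_all add: localization_functor_def)
  have local: "local_group A B f (L G)" "local_group A' B' f' (L' G)"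
    and lHom: "l G \<in> Hom G (L G)" "l' G \<in> Hom G (L' G)" if "group G" for G
    using loc[OF that] loc'[OF that] by (simp_all add: is_localization_def)
  have "\<exists>\<theta>. \<theta> \<in> iso (L G) (L' G) \<and> \<theta> \<in> Hom (L G) (L' G) \<and>
      (\<forall>x \<in> carrier G. \<theta> (l G x) = l' G x)" if G: "group G" for G
    using is_localization_iso[OF G loc[OF G] loc'[OF G]] local[OF G] same by metis
  then obtain \<theta> where \<theta>: "\<And>G. group G \<Longrightarrow> \<theta> G \<in> iso (L G) (L' G) \<and> \<theta> G \<in> Hom (L G) (L' G) \<and>
      (\<forall>x \<in> carrier G. \<theta> G (l G x) = l' G x)"
    by metis
  have "\<theta> H (L\<^sub>m G H \<phi> x) = L'\<^sub>m G H \<phi> (\<theta> G x)"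
    if G: "group G" and H: "group H" and \<phi>: "\<phi> \<in> Hom G H" and x: "x \<in> carrier (L G)" for G H \<phi> x
  proof -
    have m: "L\<^sub>m G H \<phi> \<in> Hom (L G) (L H)" "L'\<^sub>m G H \<phi> \<in> Hom (L' G) (L' H)"
      "compose (carrier G) (L\<^sub>m G H \<phi>) (l G) = compose (carrier G) (l H) \<phi>"
      "compose (carrier G) (L'\<^sub>m G H \<phi>) (l' G) = compose (carrier G) (l' H) \<phi>"
      using F F' G H \<phi> by (auto simp: localization_functor_def group_functor_def)
    have "compose (carrier (L G)) (\<theta> H) (L\<^sub>m G H \<phi>) = compose (carrier (L G)) (L'\<^sub>m G H \<phi>) (\<theta> G)"
    proof (rule is_localization_unique[OF G loc[OF G]])
      show "local_group A B f (L' H)" using local(2)[OF H] same by blast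
      show "compose (carrier (L G)) (\<theta> H) (L\<^sub>m G H \<phi>) \<in> Hom (L G) (L' H)"
        "compose (carrier (L G)) (L'\<^sub>m G H \<phi>) (\<theta> G) \<in> Hom (L G) (L' H)"
        using \<theta>[OF G] \<theta>[OF H] m(1,2) local[OF G]
        by (blast intro: compose_in_Hom local_group_def[THEN iffD1, THEN conjunct1])+
      fix y assume y: "y \<in> carrier G"
      then have "\<theta> H (L\<^sub>m G H \<phi> (l G y)) = l' H (\<phi> y)"
        using compose_eqD[OF m(3) y] \<theta>[OF H] HomD(3)[OF \<phi> y] by simp
      moreover have "L'\<^sub>m G H \<phi> (\<theta> G (l G y)) = l' H (\<phi> y)"
        using compose_eqD[OF m(4) y] \<theta>[OF G] y by simp
      ultimately show "compose (carrier (L G)) (\<theta> H) (L\<^sub>m G H \<phi>) (l G y) =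
          compose (carrier (L G)) (L'\<^sub>m G H \<phi>) (\<theta> G) (l G y)"
        using HomD(3)[OF lHom(1)[OF G] y] by (simp add: compose_eq)
    qed
    then show ?thesis using x by (rule compose_eqD)
  qed
  with \<theta> show ?thesis unfolding naturally_equivalent_def by (intro exI[of _ \<theta>]) blast
qed

section \<open>The quotient by \<open>Gamma G\<close> as a localization\<close>

definition Gamma_quotient :: "'a monoid \<Rightarrow> 'b monoid \<Rightarrow> ('a \<Rightarrow> 'b) \<Rightarrow> bool" where
  "Gamma_quotient G L l \<longleftrightarrow> group G \<and> group L \<and> l \<in> Hom G L \<and> l ` carrier G = carrier L \<and>
     kernel G L l = Gamma G"

lemma Gamma_quotient_quotient_map:
  assumes "group G"
  shows "Gamma_quotient G (G Mod Gamma G) (quotient_map G (Gamma G))"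
proof -
  interpret N: normal "Gamma G" G using assms by (rule group.Gamma_normal)
  show ?thesis
    using assms N.factorgroup_is_group quotient_map_props[OF N.normal_axioms] by (simp add: Gamma_quotient_def)
qed

text \<open>Cosets live in a set type, whereas a localization functor must stay within one type.
  Choosing coset representatives gives a copy of the quotient in the type of G, and \<theta>
  compares it with the original.\<close>

lemma Gamma_quotient_in_same_type:
  fixes G :: "'a monoid"
  assumes "group G"
  shows "\<exists>(L :: 'a monoid) l \<theta>. Gamma_quotient G L l \<and> \<theta> \<in> iso L (G Mod Gamma G) \<and>
    (\<forall>x \<in> carrier G. \<theta> (l x) = quotient_map G (Gamma G) x)"
proof -
  interpret N: normal "Gamma G" G using assms by (rule group.Gamma_normal)
  let ?Q = "G Mod Gamma G" and ?q = "quotient_map G (Gamma G)"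
  interpret Q: group ?Q by (rule N.factorgroup_is_group)
  define r where "r C = (SOME x. x \<in> C)" for C :: "'a set"
  have coset: "r C \<in> carrier G \<and> Gamma G #>\<^bsub>G\<^esub> r C = C" if "C \<in> carrier ?Q" for C
  proof -
    from that obtain c where c: "c \<in> carrier G" "C = Gamma G #>\<^bsub>G\<^esub> c"
      by (auto simp: carrier_FactGroup)
    then have "r C \<in> C"
      unfolding r_def using N.rcos_self[OF c(1) N.subgroup_axioms] by (metis someI)
    with c show ?thesis
      using N.repr_independence[OF _ c(1) N.subgroup_axioms] N.r_coset_subset_G[OF N.subset c(1)]
      by auto
  qed
  have inj: "inj_on r (carrier ?Q)" using coset by (metis inj_onI)
  let ?L = "image_group r ?Q"
  note r = Q.iso_image_group[OF inj]
  have \<theta>: "inv_into (carrier ?Q) r \<in> iso ?L ?Q" by (rule Q.iso_set_sym[OF r(1)])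
  define l where "l = compose (carrier G) r ?q"
  note q = quotient_map_props[OF N.normal_axioms]
  have ql: "?q x \<in> carrier ?Q" if "x \<in> carrier G" for x using HomD(3)[OF q(1) that] .
  have "l ` carrier G = carrier ?L"
    by (simp add: l_def image_group_carrier flip: q(2)) (simp add: compose_eq image_image cong: image_cong)
  moreover have "l \<in> Hom G ?L"
  proof -
    have "restrict r (carrier ?Q) \<in> Hom ?Q ?L"
      using r(1) by (intro restrict_in_Hom[OF Q.is_group]) (simp add: iso_def)
    from compose_in_Hom[OF assms q(1) this] show ?thesis
      using ql by (simp add: l_def compose_def cong: restrict_cong)
  qed
  moreover have "kernel G ?L l = Gamma G"
  proof -
    have "l x = \<one>\<^bsub>?L\<^esub> \<longleftrightarrow> ?q x = \<one>\<^bsub>?Q\<^esub>" if "x \<in> carrier G" for x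
      using ql[OF that] inj that Q.one_closed
      by (simp add: l_def compose_eq image_group_one inj_on_eq_iff del: one_FactGroup)
    then show ?thesis using q(3) by (auto simp: kernel_def)
  qed
  ultimately have "Gamma_quotient G ?L l" using assms r(2) by (simp add: Gamma_quotient_def)
  moreover have "inv_into (carrier ?Q) r (l x) = ?q x" if "x \<in> carrier G" for x
    using ql[OF that] inj that by (simp add: l_def compose_eq)
  ultimately show ?thesis using \<theta> by blast
qed

text \<open>The characterization of local groups enters as two implications at different types: one
  for the type of L, one for the type of the test groups.\<close>

lemma is_localization_Gamma_quotient:
  fixes L :: "'b monoid"
  assumes Q: "Gamma_quotient G L l"
    and local: "\<And>H :: 'b monoid. group H \<Longrightarrow> Gamma H = {\<one>\<^bsub>H\<^esub>} \<Longrightarrow> local_group A B f H"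
    and trivial: "\<And>H :: 'c monoid. local_group A B f H \<Longrightarrow> group H \<and> Gamma H = {\<one>\<^bsub>H\<^esub>}"
  shows "is_localization TYPE('c) A B f G L l"
proof -
  have grp: "group G" "group L" and l: "l \<in> Hom G L" "l ` carrier G = carrier L"
    "kernel G L l = Gamma G"
    using Q by (simp_all add: Gamma_quotient_def)
  interpret l: group_hom G L l
    using grp HomD(1)[OF l(1)] by (simp add: group_hom_def group_hom_axioms_def)
  have "\<exists>!\<psi>. \<psi> \<in> Hom L H \<and> compose (carrier G) \<psi> l = \<phi>"
    if H: "local_group A B f H" and \<phi>: "\<phi> \<in> Hom G H" for H :: "'c monoid" and \<phi>
  proof (rule Hom_factor_surjection[OF grp _ l(1,2) \<phi>])
    show "group H" using trivial[OF H] by blast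
    then interpret \<phi>: group_hom G H \<phi>
      using grp HomD(1)[OF \<phi>] by (simp add: group_hom_def group_hom_axioms_def)
    fix x assume "x \<in> kernel G L l"
    then show "\<phi> x = \<one>\<^bsub>H\<^esub>" using \<phi>.image_Gamma_subset trivial[OF H] l(3) by blast
  qed
  moreover have "local_group A B f L"
    using local grp(2) l.Gamma_trivial_of_kernel_eq_Gamma[OF l(2,3)] by blast
  ultimately show ?thesis using l(1) by (simp add: is_localization_def)
qed


section \<open>The universal homomorphism\<close>

lemma hom_Gamma_trivial:
  assumes "group A" "group G" "\<phi> \<in> hom A G" "Gamma G = {\<one>\<^bsub>G\<^esub>}" "x \<in> Gamma A"
  shows "\<phi> x = \<one>\<^bsub>G\<^esub>"
proof -
  interpret group_hom A G \<phi> using assms by (simp add: group_hom_def group_hom_axioms_def)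
  show ?thesis using image_Gamma_subset assms(4,5) by blast
qed

text \<open>Each element of \<open>Gamma G\<close> comes from \<open>Gamma E\<close> for a countable
  locally free E; an isomorphism moves this to a representative, where the hypothesis
  applies.\<close>

lemma Gamma_trivial_if_reps_kill:
  fixes \<Lambda> :: "'d monoid set"
  assumes reps: "countable_locally_free_reps \<Lambda>" and G: "group G"
    and kill: "\<And>D \<phi> x. D \<in> \<Lambda> \<Longrightarrow> \<phi> \<in> hom D G \<Longrightarrow> x \<in> Gamma D \<Longrightarrow> \<phi> x = \<one>\<^bsub>G\<^esub>"
  shows "Gamma G = {\<one>\<^bsub>G\<^esub>}"
proof -
  interpret G: group G by fact
  have "x = \<one>\<^bsub>G\<^esub>" if x: "x \<in> Gamma G" for x
  proof -
    obtain E :: "nat monoid" and \<phi> where E: "locally_free E" "\<phi> \<in> hom E G" "x \<in> \<phi> ` Gamma E"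
      using G.Gamma_from_countable_locally_free[OF x] by blast
    then obtain e where e: "e \<in> Gamma E" "x = \<phi> e" by blast
    obtain D f where D: "D \<in> \<Lambda>" "f \<in> iso E D"
      using reps E(1) unfolding countable_locally_free_reps_def is_iso_def by blast
    interpret E: group E using E(1) by (simp add: locally_free_def)
    interpret D: group D using reps D(1) by (auto simp: countable_locally_free_reps_def locally_free_def)
    interpret f: group_hom E D f
      using D(2) by (simp add: group_hom_def group_hom_axioms_def E.is_group D.is_group iso_def)
    have "e \<in> carrier E"
      by (rule subgroup.mem_carrier[OF normal_imp_subgroup[OF E.Gamma_normal] e(1)])
    then have "inv_into (carrier E) f (f e) = e" using D(2) by (simp add: iso_iff)
    moreover have "\<phi> \<circ> inv_into (carrier E) f \<in> hom D G"
      using E.iso_set_sym[OF D(2)] E(2) by (auto simp: iso_def intro: Group.hom_compose)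
    moreover have "f e \<in> Gamma D" using e(1) f.image_Gamma_subset by blast
    ultimately show ?thesis using kill[OF D(1), of "\<phi> \<circ> inv_into (carrier E) f" "f e"] e(2) by simp
  qed
  moreover have "\<one>\<^bsub>G\<^esub> \<in> Gamma G"
    by (rule subgroup.one_closed[OF normal_imp_subgroup[OF G.Gamma_normal]])
  ultimately show ?thesis by blast
qed

context
  fixes \<Lambda> :: "'d monoid set"
  assumes reps: "countable_locally_free_reps \<Lambda>"
begin

lemma group_rep: "D \<in> \<Lambda> \<Longrightarrow> group D"
  using reps by (auto simp: countable_locally_free_reps_def locally_free_def)

abbreviation (input) "\<F> \<equiv> free_product \<Lambda> (\<lambda>D. D)"
abbreviation (input) "\<iota> \<equiv> free_product_incl \<Lambda> (\<lambda>D. D)"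
abbreviation (input) "\<N> \<equiv> normal_closure \<F> (\<Union>D \<in> \<Lambda>. \<iota> D ` Gamma D)"

lemma group_free_product_reps: "group \<F>"
  by (rule group_free_product) (rule group_rep)

lemma incl_hom: "D \<in> \<Lambda> \<Longrightarrow> group_hom D \<F> (\<iota> D)"
  using free_product_incl_hom[of \<Lambda> "\<lambda>D. D" D] group_rep group_free_product_reps
  by (simp add: group_hom_def group_hom_axioms_def)

lemma Gamma_rep_subset: "D \<in> \<Lambda> \<Longrightarrow> Gamma D \<subseteq> carrier D"
  by (rule subgroup.subset[OF normal_imp_subgroup[OF group.Gamma_normal[OF group_rep]]])

lemma incl_Gamma_subset: "(\<Union>D \<in> \<Lambda>. \<iota> D ` Gamma D) \<subseteq> carrier \<F>"
  using group_hom.hom_closed[OF incl_hom] Gamma_rep_subset by blast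

text \<open>A homomorphism from one factor extends to the free product by trivial maps on the
  others.\<close>

lemma Gamma_trivial_if_free_product_kills:
  assumes G: "group G"
    and kill: "\<And>\<phi> D x. \<phi> \<in> hom \<F> G \<Longrightarrow> D \<in> \<Lambda> \<Longrightarrow> x \<in> Gamma D \<Longrightarrow> \<phi> (\<iota> D x) = \<one>\<^bsub>G\<^esub>"
  shows "Gamma G = {\<one>\<^bsub>G\<^esub>}"
proof (rule Gamma_trivial_if_reps_kill[OF reps G])
  fix D \<phi> x assume D: "D \<in> \<Lambda>" and \<phi>: "\<phi> \<in> hom D G" and x: "x \<in> Gamma D"
  interpret G: group G by fact
  define \<psi> where "\<psi> E = (if E = D then \<phi> else (\<lambda>_. \<one>\<^bsub>G\<^esub>))" for E
  have "\<psi> E \<in> hom E G" for E using \<phi> by (auto simp: \<psi>_def hom_def)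
  then obtain \<Phi> where "\<Phi> \<in> hom \<F> G"
    "\<And>E y. E \<in> \<Lambda> \<Longrightarrow> y \<in> carrier E \<Longrightarrow> \<Phi> (\<iota> E y) = \<psi> E y"
    using free_product_lift[of \<Lambda> "\<lambda>D. D" G \<psi>] group_rep G by metis
  with kill[of \<Phi> D x] D x Gamma_rep_subset[OF D] show "\<phi> x = \<one>\<^bsub>G\<^esub>" by (auto simp: \<psi>_def)
qed

text \<open>\<open>Gamma\<close> of the free product contains the image of each
  \<open>Gamma D\<close>, and it is mapped into \<open>Gamma G\<close> by every
  homomorphism.\<close>

lemma local_group_Gamma_iff:
  "local_group \<F> (\<F> Mod Gamma \<F>) (quotient_map \<F> (Gamma \<F>)) G \<longleftrightarrow>
     group G \<and> Gamma G = {\<one>\<^bsub>G\<^esub>}"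
proof -
  have "\<iota> D x \<in> Gamma \<F>" if "D \<in> \<Lambda>" "x \<in> Gamma D" for D x
    using group_hom.image_Gamma_subset[OF incl_hom[OF that(1)]] that(2) by blast
  moreover have "\<phi> x = \<one>\<^bsub>G\<^esub>"
    if "group G" "Gamma G = {\<one>\<^bsub>G\<^esub>}" "\<phi> \<in> hom \<F> G" "x \<in> Gamma \<F>" for \<phi> x
    by (rule hom_Gamma_trivial[OF group_free_product_reps that(1,3,2,4)])
  ultimately show ?thesis
    unfolding local_group_quotient_map_iff[OF group_free_product_reps
        group.Gamma_normal[OF group_free_product_reps]]
    using Gamma_trivial_if_free_product_kills[of G] by blast
qed

text \<open>Kernels are normal, so killing the normal closure amounts to killing the images of the
  groups \<open>Gamma D\<close>.\<close>

lemma local_group_normal_closure_iff: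
  "local_group \<F> (\<F> Mod \<N>) (quotient_map \<F> \<N>) G \<longleftrightarrow> group G \<and> Gamma G = {\<one>\<^bsub>G\<^esub>}"
proof -
  interpret F: group \<F> by (rule group_free_product_reps)
  have "\<phi> x = \<one>\<^bsub>G\<^esub>" if G: "group G" "Gamma G = {\<one>\<^bsub>G\<^esub>}" and \<phi>: "\<phi> \<in> hom \<F> G" and x: "x \<in> \<N>" for \<phi> x
  proof -
    interpret \<phi>: group_hom \<F> G \<phi>
      using G \<phi> by (simp add: group_hom_def group_hom_axioms_def F.is_group)
    have "\<phi> (\<iota> D y) = \<one>\<^bsub>G\<^esub>" if D: "D \<in> \<Lambda>" and y: "y \<in> Gamma D" for D y
      using hom_Gamma_trivial[OF group_rep[OF D] G(1) _ G(2) y, of "\<phi> \<circ> \<iota> D"]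
        group_hom.homh[OF incl_hom[OF D]] \<phi> by (simp add: Group.hom_compose)
    moreover have "\<iota> D y \<in> carrier \<F>" if "D \<in> \<Lambda>" "y \<in> Gamma D" for D y
      using incl_Gamma_subset that by blast
    ultimately have "(\<Union>D \<in> \<Lambda>. \<iota> D ` Gamma D) \<subseteq> kernel \<F> G \<phi>"
      by (auto simp: kernel_def)
    from F.normal_closure_least[OF \<phi>.normal_kernel this] x show ?thesis by (auto simp: kernel_def)
  qed
  moreover have "\<iota> D x \<in> \<N>" if "D \<in> \<Lambda>" "x \<in> Gamma D" for D x
    by (rule subsetD[OF F.subset_normal_closure]) (use that in blast)
  ultimately show ?thesis
    unfolding local_group_quotient_map_iff[OF F.is_group F.normal_normal_closure[OF incl_Gamma_subset]]
    using Gamma_trivial_if_free_product_kills[of G] by blast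
qed

end

theorem theorem2p5:
  fixes \<Lambda> :: "'d monoid set"
    and \<D> :: "('d monoid \<times> 'd) list set monoid"
  assumes "countable_locally_free_reps \<Lambda>"
    and "\<D> = free_product \<Lambda> (\<lambda>D. D)"
    and "\<D>' = normal_closure \<D> (\<Union>D \<in> \<Lambda>. free_product_incl \<Lambda> (\<lambda>D. D) D ` Gamma D)"
    and "h = quotient_map \<D> \<D>'"
    and "g = quotient_map \<D> (Gamma \<D>)"
  shows "same_localization_class TYPE('u) \<D> (\<D> Mod Gamma \<D>) g \<D> (\<D> Mod \<D>') h \<and>
    (\<forall>(L :: 'u monoid \<Rightarrow> 'u monoid) L\<^sub>m l.
       localization_functor \<D> (\<D> Mod Gamma \<D>) g L L\<^sub>m l \<longrightarrow>
         (\<forall>G. group G \<longrightarrow>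
            (\<exists>\<theta> \<in> iso (L G) (G Mod Gamma G).
               \<forall>x \<in> carrier G. \<theta> (l G x) = quotient_map G (Gamma G) x))) \<and>
    (\<forall>G :: 'a monoid. group G \<longrightarrow>
       is_localization TYPE('c) \<D> (\<D> Mod Gamma \<D>) g
         G (G Mod Gamma G) (quotient_map G (Gamma G)))"
proof -
  note local_g = local_group_Gamma_iff[OF assms(1), folded assms(2), folded assms(5)]
  note local_h = local_group_normal_closure_iff[OF assms(1), folded assms(2), folded assms(3),
      folded assms(4)]
  have "\<exists>(L :: 'u monoid) l \<theta>. Gamma_quotient G L l \<and> \<theta> \<in> iso L (G Mod Gamma G) \<and>
      (\<forall>x \<in> carrier G. \<theta> (l x) = quotient_map G (Gamma G) x)" if "group G" for G :: "'u monoid"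
    by (rule Gamma_quotient_in_same_type[OF that])
  then obtain L :: "'u monoid \<Rightarrow> 'u monoid" and l \<theta> where L:
    "\<And>G. group G \<Longrightarrow> Gamma_quotient G (L G) (l G) \<and> \<theta> G \<in> iso (L G) (G Mod Gamma G) \<and>
      (\<forall>x \<in> carrier G. \<theta> G (l G x) = quotient_map G (Gamma G) x)"
    by metis
  \<comment> \<open>The same model serves g and h, since both have the same local groups.\<close>
  have loc_g: "is_localization TYPE('u) \<D> (\<D> Mod Gamma \<D>) g G (L G) (l G)" if "group G" for G
    by (rule is_localization_Gamma_quotient) (use L[OF that] local_g in blast)+
  have loc_h: "is_localization TYPE('u) \<D> (\<D> Mod \<D>') h G (L G) (l G)" if "group G" for G
    by (rule is_localization_Gamma_quotient) (use L[OF that] local_h in blast)+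
  have "same_localization_class TYPE('u) \<D> (\<D> Mod Gamma \<D>) g \<D> (\<D> Mod \<D>') h"
    unfolding same_localization_class_def
  proof (intro conjI allI impI)
    show "\<exists>(L :: 'u monoid \<Rightarrow> 'u monoid) L\<^sub>m l. localization_functor \<D> (\<D> Mod Gamma \<D>) g L L\<^sub>m l"
      using localization_functor_exists[OF loc_g] by blast
    show "\<exists>(L :: 'u monoid \<Rightarrow> 'u monoid) L\<^sub>m l. localization_functor \<D> (\<D> Mod \<D>') h L L\<^sub>m l"
      using localization_functor_exists[OF loc_h] by blast
    fix L :: "'u monoid \<Rightarrow> 'u monoid" and L\<^sub>m l and L' :: "'u monoid \<Rightarrow> 'u monoid" and L'\<^sub>m l'
    assume "localization_functor \<D> (\<D> Mod Gamma \<D>) g L L\<^sub>m l \<and>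
      localization_functor \<D> (\<D> Mod \<D>') h L' L'\<^sub>m l'"
    then show "naturally_equivalent L L\<^sub>m L' L'\<^sub>m"
      using naturally_equivalentI local_g local_h by metis
  qed
  moreover have "\<exists>\<theta> \<in> iso (L' G) (G Mod Gamma G).
      \<forall>x \<in> carrier G. \<theta> (l' G x) = quotient_map G (Gamma G) x"
    if F: "localization_functor \<D> (\<D> Mod Gamma \<D>) g L' L\<^sub>m l'" and G: "group G"
    for L' :: "'u monoid \<Rightarrow> 'u monoid" and L\<^sub>m l' G
  proof -
    have loc': "is_localization TYPE('u) \<D> (\<D> Mod Gamma \<D>) g G (L' G) (l' G)"
      using F G by (simp add: localization_functor_def)
    \<comment> \<open>An arbitrary localization functor is compared with the model L first, and then
      with the quotient through \<theta>.\<close>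
    have "local_group \<D> (\<D> Mod Gamma \<D>) g (L G)" "local_group \<D> (\<D> Mod Gamma \<D>) g (L' G)"
      using loc' loc_g[OF G] by (simp_all add: is_localization_def)
    from is_localization_iso[OF G loc' loc_g[OF G] this]
    obtain \<eta> where \<eta>: "\<eta> \<in> iso (L' G) (L G)" "\<And>x. x \<in> carrier G \<Longrightarrow> \<eta> (l' G x) = l G x"
      by blast
    have "\<theta> G \<circ> \<eta> \<in> iso (L' G) (G Mod Gamma G)"
      using \<eta>(1) L[OF G] by (blast intro: iso_set_trans)
    then show ?thesis using \<eta>(2) L[OF G] by (intro bexI[of _ "\<theta> G \<circ> \<eta>"]) simp_all
  qed
  moreover have "is_localization TYPE('c) \<D> (\<D> Mod Gamma \<D>) g
      G (G Mod Gamma G) (quotient_map G (Gamma G))" if "group G" for G :: "'a monoid"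
    by (rule is_localization_Gamma_quotient)
      (use Gamma_quotient_quotient_map[OF that] local_g in blast)+
  ultimately show ?thesis by blast
qed

end
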